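(* Let $M$ and $N$ be left cancellative, finitely presentable monoids which are quasi-isometric. Then $M$ has solvable word problem if and only if $N$ has solvable word problem.
   Context: A monoid $M$ is left cancellative if $xy=xz$ implies $y=z$ for all $x,y,z\in M$. A monoid is finitely presentable if it is isomorphic to the monoid defined by a monoid presentation $\langle A\mid R\rangle$ with $A$ and $R$ finite. A finitely generated monoid has solvable word problem if, for a finite generating set $A$, there is an algorithm which given two words over $A$ decides whether they represent the same element (this does not depend on the choice of finite generating set). Let $\mathbb{R}^\infty=\mathbb{R}^{\ge 0}\cup\{\infty\}$ with the obvious order, addition and multiplication ($0\cdot\infty$ undefined; $\infty/\lambda-\epsilon=\infty$). A semimetric on a set $X$ is a function $d:X\times X\to\mathbb{R}^\infty$ such that $d(x,y)=0$ if and only if $x=y$, and $d(x,z)\le d(x,y)+d(y,z)$ for all $x,y,z$ (symmetry is not required). A semimetric space is a set with a semimetric. Let $1\le\lambda<\infty$, $0\le\mu<\infty$, $0<\epsilon<\infty$. A map $f:X\to Y$ between semimetric spaces is a $(\lambda,\epsilon)$-quasi-isometric embedding if $\frac1\lambda d_X(x,y)-\epsilon\le d_Y(f(x),f(y))\le\lambda d_X(x,y)+\epsilon$ for all $x,y\in X$. A subset $Z\subseteq Y$ is $\mu$-quasi-dense if for every $y\in Y$ there is $z\in Z$ with $d_Y(y,z)\le\mu$ and $d_Y(z,y)\le\mu$. A $(\lambda,\epsilon,\mu)$-quasi-isometry is a $(\lambda,\epsilon)$-quasi-isometric embedding whose image is $\mu$-quasi-dense. $X$ and $Y$ are quasi-isometric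 if there is a $(\lambda,\epsilon,\mu)$-quasi-isometry $X\to Y$ for some such constants; this is an equivalence relation. For a monoid $M$ generated by a finite subset $S$, define the semimetric $d_S$ on $M$ by letting $d_S(x,y)$ be the shortest length of a word $w$ over $S$ with $xw=y$ in $M$, or $\infty$ if there is no such word. Different finite generating sets of the same monoid give quasi-isometric semimetric spaces. Two finitely generated monoids are quasi-isometric if the semimetric spaces so obtained from (any) finite generating sets are quasi-isometric. *)

theory Defs
  imports "HOL-Algebra.Group" "HOL-Library.Nat_Bijection"
    "HOL-Library.Extended_Nonnegative_Real"
begin

definition left_cancellative :: "('a, 'm) monoid_scheme \<Rightarrow> bool" where
  "left_cancellative M \<longleftrightarrow>
    (\<forall>x\<in>carrier M. \<forall>y\<in>carrier M. \<forall>z\<in>carrier M.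
       x \<otimes>\<^bsub>M\<^esub> y = x \<otimes>\<^bsub>M\<^esub> z \<longrightarrow> y = z)"

definition word_val :: "('a, 'm) monoid_scheme \<Rightarrow> 'a list \<Rightarrow> 'a" where
  "word_val M w = foldr (\<lambda>x y. x \<otimes>\<^bsub>M\<^esub> y) w \<one>\<^bsub>M\<^esub>"

(* Generation as a monoid (HOL-Algebra's "generate" also closes under inverses). *)
definition generates :: "('a, 'm) monoid_scheme \<Rightarrow> 'a set \<Rightarrow> bool" where
  "generates M S \<longleftrightarrow> S \<subseteq> carrier M \<and> carrier M = word_val M ` lists S"

(* For R \<subseteq> lists A \<times> lists A: the least congruence on the free monoid lists A containing R. *)
inductive_set pres_cong :: "'x set \<Rightarrow> ('x list \<times> 'x list) set \<Rightarrow> ('x list \<times> 'x list) set"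
  for A R where
  base: "(u, v) \<in> R \<Longrightarrow> (u, v) \<in> pres_cong A R"
| refl: "u \<in> lists A \<Longrightarrow> (u, u) \<in> pres_cong A R"
| sym: "(u, v) \<in> pres_cong A R \<Longrightarrow> (v, u) \<in> pres_cong A R"
| trans: "(u, v) \<in> pres_cong A R \<Longrightarrow> (v, w) \<in> pres_cong A R \<Longrightarrow> (u, w) \<in> pres_cong A R"
| in_context: "(u, v) \<in> pres_cong A R \<Longrightarrow> p \<in> lists A \<Longrightarrow> q \<in> lists A \<Longrightarrow>
    (p @ u @ q, p @ v @ q) \<in> pres_cong A R"

definition presented_monoid :: "'x set \<Rightarrow> ('x list \<times> 'x list) set \<Rightarrow> 'x list set monoid" where
  "presented_monoid A R =
    \<lparr>carrier = lists A // pres_cong A R,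
     mult = (\<lambda>U V. \<Union>u\<in>U. \<Union>v\<in>V. pres_cong A R `` {u @ v}),
     one = pres_cong A R `` {[]}\<rparr>"

(* Finite alphabets are taken, without loss of generality, to be sets of naturals. *)
definition finitely_presentable :: "('a, 'm) monoid_scheme \<Rightarrow> bool" where
  "finitely_presentable M \<longleftrightarrow>
    (\<exists>(A :: nat set) R. finite A \<and> finite R \<and> R \<subseteq> lists A \<times> lists A \<and>
       M \<cong> presented_monoid A R)"

(* recursive_fn k f: on arguments xs of length k, f is a total recursive (general recursive,
   i.e. Turing computable) function of k variables. In rule mini the minimisation is regular,
   so exactly the total computable functions arise; values of f on lists of other lengths are
   irrelevant (rule ext). *)
inductive recursive_fn :: "nat \<Rightarrow> (nat list \<Rightarrow> nat) \<Rightarrow> bool" where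
  zero: "recursive_fn k (\<lambda>_. 0)"
| succ: "recursive_fn 1 (\<lambda>xs. Suc (xs ! 0))"
| proj: "i < k \<Longrightarrow> recursive_fn k (\<lambda>xs. xs ! i)"
| comp: "recursive_fn (length fs) g \<Longrightarrow> \<forall>f\<in>set fs. recursive_fn k f \<Longrightarrow>
    recursive_fn k (\<lambda>xs. g (map (\<lambda>f. f xs) fs))"
| prim: "recursive_fn k g \<Longrightarrow> recursive_fn (Suc (Suc k)) h \<Longrightarrow>
    recursive_fn (Suc k) (\<lambda>xs. rec_nat (g (tl xs)) (\<lambda>n r. h (n # r # tl xs)) (hd xs))"
| mini: "recursive_fn (Suc k) f \<Longrightarrow> \<forall>xs. length xs = k \<longrightarrow> (\<exists>n. f (n # xs) = 0) \<Longrightarrow>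
    recursive_fn k (\<lambda>xs. LEAST n. f (n # xs) = 0)"
| ext: "recursive_fn k f \<Longrightarrow> \<forall>xs. length xs = k \<longrightarrow> g xs = f xs \<Longrightarrow> recursive_fn k g"

(* Letters of the finite set A are named by naturals via c, words over A by list_encode. *)
definition solvable_word_problem :: "('a, 'm) monoid_scheme \<Rightarrow> bool" where
  "solvable_word_problem M \<longleftrightarrow>
    (\<exists>A (c :: 'a \<Rightarrow> nat) f. finite A \<and> generates M A \<and> inj_on c A \<and> recursive_fn 2 f \<and>
       (\<forall>u\<in>lists A. \<forall>v\<in>lists A.
          f [list_encode (map c u), list_encode (map c v)] =
            (if word_val M u = word_val M v then 1 else 0)))"

definition semimetric :: "'a set \<Rightarrow> ('a \<Rightarrow> 'a \<Rightarrow> ennreal) \<Rightarrow> bool" where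
  "semimetric X d \<longleftrightarrow>
    (\<forall>x\<in>X. \<forall>y\<in>X. d x y = 0 \<longleftrightarrow> x = y) \<and>
    (\<forall>x\<in>X. \<forall>y\<in>X. \<forall>z\<in>X. d x z \<le> d x y + d y z)"

(* Subtraction on ennreal truncates at 0, which does not affect the lower bound since
   distances are nonnegative; also \<infinity> / lam - \<epsilon> = \<infinity>. *)
definition quasi_isometric_embedding ::
  "real \<Rightarrow> real \<Rightarrow> 'a set \<Rightarrow> ('a \<Rightarrow> 'a \<Rightarrow> ennreal) \<Rightarrow> 'b set \<Rightarrow> ('b \<Rightarrow> 'b \<Rightarrow> ennreal) \<Rightarrow> ('a \<Rightarrow> 'b) \<Rightarrow> bool"
  where
  "quasi_isometric_embedding lam \<epsilon> X dX Y dY f \<longleftrightarrow>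
    f \<in> X \<rightarrow> Y \<and>
    (\<forall>x\<in>X. \<forall>y\<in>X.
       dX x y / ennreal lam - ennreal \<epsilon> \<le> dY (f x) (f y) \<and>
       dY (f x) (f y) \<le> ennreal lam * dX x y + ennreal \<epsilon>)"

definition quasi_dense :: "real \<Rightarrow> 'b set \<Rightarrow> 'b set \<Rightarrow> ('b \<Rightarrow> 'b \<Rightarrow> ennreal) \<Rightarrow> bool" where
  "quasi_dense \<mu> Z Y d \<longleftrightarrow>
    Z \<subseteq> Y \<and> (\<forall>y\<in>Y. \<exists>z\<in>Z. d y z \<le> ennreal \<mu> \<and> d z y \<le> ennreal \<mu>)"

definition quasi_isometry ::
  "real \<Rightarrow> real \<Rightarrow> real \<Rightarrow> 'a set \<Rightarrow> ('a \<Rightarrow> 'a \<Rightarrow> ennreal) \<Rightarrow> 'b set \<Rightarrow> ('b \<Rightarrow> 'b \<Rightarrow> ennreal) \<Rightarrow>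
   ('a \<Rightarrow> 'b) \<Rightarrow> bool" where
  "quasi_isometry lam \<epsilon> \<mu> X dX Y dY f \<longleftrightarrow>
    quasi_isometric_embedding lam \<epsilon> X dX Y dY f \<and> quasi_dense \<mu> (f ` X) Y dY"

definition quasi_isometric ::
  "'a set \<Rightarrow> ('a \<Rightarrow> 'a \<Rightarrow> ennreal) \<Rightarrow> 'b set \<Rightarrow> ('b \<Rightarrow> 'b \<Rightarrow> ennreal) \<Rightarrow> bool" where
  "quasi_isometric X dX Y dY \<longleftrightarrow>
    (\<exists>lam \<epsilon> \<mu> f. 1 \<le> lam \<and> 0 < \<epsilon> \<and> 0 \<le> \<mu> \<and> quasi_isometry lam \<epsilon> \<mu> X dX Y dY f)"

(* The infimum of the empty set is \<infinity>. *)
definition word_dist :: "('a, 'm) monoid_scheme \<Rightarrow> 'a set \<Rightarrow> 'a \<Rightarrow> 'a \<Rightarrow> ennreal" where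
  "word_dist M S x y =
    (INF w\<in>{w \<in> lists S. x \<otimes>\<^bsub>M\<^esub> word_val M w = y}. of_nat (length w))"

definition quasi_isometric_monoids ::
  "('a, 'm) monoid_scheme \<Rightarrow> ('b, 'n) monoid_scheme \<Rightarrow> bool" where
  "quasi_isometric_monoids M N \<longleftrightarrow>
    (\<exists>S T. finite S \<and> generates M S \<and> finite T \<and> generates N T \<and>
       quasi_isometric (carrier M) (word_dist M S) (carrier N) (word_dist N T))"

lemma pres_cong_subset:
  assumes "R \<subseteq> lists A \<times> lists A"
  shows "pres_cong A R \<subseteq> lists A \<times> lists A"
proof -
  have "u \<in> lists A \<and> v \<in> lists A" if "(u, v) \<in> pres_cong A R" for u v
    using that by (induction rule: pres_cong.induct) (use assms in auto)
  then show ?thesis by auto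
qed

lemma equiv_pres_cong:
  assumes "R \<subseteq> lists A \<times> lists A"
  shows "equiv (lists A) (pres_cong A R)"
  using pres_cong_subset[OF assms]
  by (intro equivI refl_onI symI transI)
    (auto intro: pres_cong.refl pres_cong.sym pres_cong.trans)

lemma pres_cong_append:
  assumes R: "R \<subseteq> lists A \<times> lists A"
    and u: "(u, u') \<in> pres_cong A R" and v: "(v, v') \<in> pres_cong A R"
  shows "(u @ v, u' @ v') \<in> pres_cong A R"
proof -
  have L: "u' \<in> lists A" "v \<in> lists A" using pres_cong_subset[OF R] u v by auto
  have "(u @ v, u' @ v) \<in> pres_cong A R"
    using pres_cong.in_context[OF u, of "[]" v] L by simp
  moreover have "(u' @ v, u' @ v') \<in> pres_cong A R"
    using pres_cong.in_context[OF v, of u' "[]"] L by simp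
  ultimately show ?thesis by (rule pres_cong.trans)
qed

lemma presented_monoid_mult:
  assumes R: "R \<subseteq> lists A \<times> lists A" and "u \<in> lists A" "v \<in> lists A"
  shows "pres_cong A R `` {u} \<otimes>\<^bsub>presented_monoid A R\<^esub> pres_cong A R `` {v}
       = pres_cong A R `` {u @ v}"
proof -
  have eq: "pres_cong A R `` {u' @ v'} = pres_cong A R `` {u @ v}"
    if "(u, u') \<in> pres_cong A R" "(v, v') \<in> pres_cong A R" for u' v'
    using equiv_class_eq[OF equiv_pres_cong[OF R] pres_cong_append[OF R that]] by simp
  have uu: "u \<in> pres_cong A R `` {u}" and vv: "v \<in> pres_cong A R `` {v}"
    using assms(2,3) by (simp_all add: pres_cong.refl)
  have "(\<Union>u'\<in>pres_cong A R `` {u}. \<Union>v'\<in>pres_cong A R `` {v}. pres_cong A R `` {u' @ v'})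
      = (\<Union>u'\<in>pres_cong A R `` {u}. \<Union>v'\<in>pres_cong A R `` {v}. pres_cong A R `` {u @ v})"
    by (intro SUP_cong HOL.refl eq) simp_all
  also have "\<dots> = pres_cong A R `` {u @ v}" using uu vv by blast
  finally show ?thesis by (simp add: presented_monoid_def)
qed

lemma monoid_presented_monoid:
  assumes R: "R \<subseteq> lists A \<times> lists A"
  shows "monoid (presented_monoid A R)"
proof -
  let ?P = "presented_monoid A R"
  have E: "\<exists>u\<in>lists A. U = pres_cong A R `` {u}" if "U \<in> carrier ?P" for U
    using that by (auto simp: presented_monoid_def elim: quotientE)
  have C: "pres_cong A R `` {u} \<in> carrier ?P" if "u \<in> lists A" for u
    using that by (simp add: presented_monoid_def quotientI)
  have one: "\<one>\<^bsub>?P\<^esub> = pres_cong A R `` {[]}" by (simp add: presented_monoid_def)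
  note mult = presented_monoid_mult[OF R]
  have mult_closed: "U \<otimes>\<^bsub>?P\<^esub> V \<in> carrier ?P" if U: "U \<in> carrier ?P" and V: "V \<in> carrier ?P" for U V
  proof -
    obtain u where u: "u \<in> lists A" "U = pres_cong A R `` {u}" using E[OF U] by blast
    obtain v where v: "v \<in> lists A" "V = pres_cong A R `` {v}" using E[OF V] by blast
    have "u @ v \<in> lists A" using u(1) v(1) by simp
    then show ?thesis unfolding u(2) v(2) mult[OF u(1) v(1)] by (rule C)
  qed
  have assoc: "U \<otimes>\<^bsub>?P\<^esub> V \<otimes>\<^bsub>?P\<^esub> W = U \<otimes>\<^bsub>?P\<^esub> (V \<otimes>\<^bsub>?P\<^esub> W)"
    if U: "U \<in> carrier ?P" and V: "V \<in> carrier ?P" and W: "W \<in> carrier ?P" for U V W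
  proof -
    obtain u where u: "u \<in> lists A" "U = pres_cong A R `` {u}" using E[OF U] by blast
    obtain v where v: "v \<in> lists A" "V = pres_cong A R `` {v}" using E[OF V] by blast
    obtain w where w: "w \<in> lists A" "W = pres_cong A R `` {w}" using E[OF W] by blast
    have uv: "u @ v \<in> lists A" and vw: "v @ w \<in> lists A" using u(1) v(1) w(1) by simp_all
    show ?thesis
      unfolding u(2) v(2) w(2) mult[OF u(1) v(1)] mult[OF v(1) w(1)] mult[OF uv w(1)]
        mult[OF u(1) vw] append_assoc by (rule HOL.refl)
  qed
  have unit: "\<one>\<^bsub>?P\<^esub> \<otimes>\<^bsub>?P\<^esub> U = U" "U \<otimes>\<^bsub>?P\<^esub> \<one>\<^bsub>?P\<^esub> = U" if U: "U \<in> carrier ?P" for U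
  proof -
    obtain u where u: "u \<in> lists A" "U = pres_cong A R `` {u}" using E[OF U] by blast
    have nil: "[] \<in> lists A" by simp
    show "\<one>\<^bsub>?P\<^esub> \<otimes>\<^bsub>?P\<^esub> U = U" unfolding u(2) one mult[OF nil u(1)] by simp
    show "U \<otimes>\<^bsub>?P\<^esub> \<one>\<^bsub>?P\<^esub> = U" unfolding u(2) one mult[OF u(1) nil] by simp
  qed
  have "\<one>\<^bsub>?P\<^esub> \<in> carrier ?P" unfolding one by (rule C) simp
  with mult_closed assoc unit show ?thesis unfolding monoid_def by blast
qed

lemma word_val_closed:
  assumes "monoid M" "S \<subseteq> carrier M" "w \<in> lists S"
  shows "word_val M w \<in> carrier M"
proof -
  interpret monoid M by fact
  show ?thesis using assms(3) assms(2) by (induction w) (auto simp: word_val_def)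
qed

lemma word_val_append:
  assumes "monoid M" "S \<subseteq> carrier M" "v \<in> lists S" "w \<in> lists S"
  shows "word_val M (v @ w) = word_val M v \<otimes>\<^bsub>M\<^esub> word_val M w"
proof -
  interpret monoid M by fact
  note closed = word_val_closed[OF assms(1,2)]
  show ?thesis using assms(3)
  proof (induction v)
    case Nil
    then show ?case using closed[OF assms(4)] by (simp add: word_val_def)
  next
    case (Cons a v)
    then show ?case
      using closed[OF assms(4)] closed[of v] assms(2) by (auto simp: word_val_def m_assoc)
  qed
qed

lemma word_dist_attained:
  assumes "word_dist M S x y < \<infinity>"
  obtains w where "w \<in> lists S" "x \<otimes>\<^bsub>M\<^esub> word_val M w = y" "word_dist M S x y = of_nat (length w)"
proof -
  let ?W = "{w \<in> lists S. x \<otimes>\<^bsub>M\<^esub> word_val M w = y}"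
  have "?W \<noteq> {}"
  proof
    assume "?W = {}"
    then have "word_dist M S x y = \<infinity>" unfolding word_dist_def by (simp only: INF_empty infinity_ennreal_def)
    with assms show False by simp
  qed
  then obtain w0 where "w0 \<in> ?W" by blast
  define w where "w = arg_min length (\<lambda>v. v \<in> ?W)"
  note min = arg_min_nat_lemma[of "\<lambda>v. v \<in> ?W" w0 length, OF \<open>w0 \<in> ?W\<close>, folded w_def]
  have w: "w \<in> ?W" using min by (rule conjunct1)
  have le: "length w \<le> length v" if "v \<in> ?W" for v using min that by (blast dest: conjunct2)
  have "word_dist M S x y = of_nat (length w)"
    unfolding word_dist_def
  proof (rule antisym)
    show "(INF v\<in>?W. of_nat (length v) :: ennreal) \<le> of_nat (length w)"
      using w by (rule INF_lower)
    show "of_nat (length w) \<le> (INF v\<in>?W. of_nat (length v) :: ennreal)"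
      by (rule INF_greatest) (simp only: of_nat_le_iff le)
  qed
  moreover have "w \<in> lists S" "x \<otimes>\<^bsub>M\<^esub> word_val M w = y" using w by simp_all
  ultimately show thesis by (intro that)
qed

lemma word_dist_le:
  assumes "w \<in> lists S" "x \<otimes>\<^bsub>M\<^esub> word_val M w = y"
  shows "word_dist M S x y \<le> of_nat (length w)"
  unfolding word_dist_def using assms by (intro INF_lower) simp

lemma semimetric_word_dist:
  assumes "monoid M" "S \<subseteq> carrier M"
  shows "semimetric (carrier M) (word_dist M S)"
proof -
  interpret monoid M by fact
  have "word_dist M S x y = 0 \<longleftrightarrow> x = y" if "x \<in> carrier M" for x y
  proof
    assume 0: "word_dist M S x y = 0"
    then have "word_dist M S x y < \<infinity>" by simp
    then obtain w where "x \<otimes>\<^bsub>M\<^esub> word_val M w = y" "word_dist M S x y = of_nat (length w)"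
      by (rule word_dist_attained)
    with 0 have "x \<otimes>\<^bsub>M\<^esub> word_val M w = y" "length w = 0" by simp_all
    then show "x = y" using that by (simp add: word_val_def)
  next
    assume "x = y"
    then show "word_dist M S x y = 0"
      using word_dist_le[of "[]" S M x y] that by (simp add: word_val_def)
  qed
  moreover have "word_dist M S x z \<le> word_dist M S x y + word_dist M S y z"
    if x: "x \<in> carrier M" for x y z
  proof (cases "word_dist M S x y < \<infinity> \<and> word_dist M S y z < \<infinity>")
    case True
    obtain v where v: "v \<in> lists S" "x \<otimes>\<^bsub>M\<^esub> word_val M v = y"
      "word_dist M S x y = of_nat (length v)" using True by (blast elim: word_dist_attained)
    obtain w where w: "w \<in> lists S" "y \<otimes>\<^bsub>M\<^esub> word_val M w = z"
      "word_dist M S y z = of_nat (length w)" using True by (blast elim: word_dist_attained)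
    have "x \<otimes>\<^bsub>M\<^esub> word_val M (v @ w) = x \<otimes>\<^bsub>M\<^esub> word_val M v \<otimes>\<^bsub>M\<^esub> word_val M w"
      unfolding word_val_append[OF assms v(1) w(1)]
      by (rule m_assoc[symmetric, OF x word_val_closed[OF assms v(1)] word_val_closed[OF assms w(1)]])
    then have "x \<otimes>\<^bsub>M\<^esub> word_val M (v @ w) = z" by (simp only: v(2) w(2))
    then have "word_dist M S x z \<le> of_nat (length (v @ w))"
      using v(1) w(1) by (intro word_dist_le) simp_all
    then show ?thesis unfolding v(3) w(3) by simp
  next
    case False
    then show ?thesis by (auto simp: less_top[symmetric])
  qed
  ultimately show ?thesis unfolding semimetric_def by blast
qed

end

theory Submission
  imports Defs
begin

text \<open>Let \<open>u = v\<close> in \<open>N\<close>. A quasi-isometry \<open>N \<rightarrow> M\<close> carries the paths \<open>u\<close>, \<open>v\<close> in the Cayley graph to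
  paths \<open>U\<close>, \<open>V\<close> with common endpoints, whose lengths are linearly bounded; left cancellativity gives
  \<open>U = V\<close> in \<open>M\<close>. The number of steps of a derivation of \<open>V\<close> from \<open>U\<close> has a recursive bound \<open>D\<close>,
  because with a solvable word problem one can search for derivations of all equal pairs of words of
  bounded length. A quasi-inverse carries the derivation back to \<open>N\<close>: each relation of \<open>M\<close> becomes,
  again by left cancellativity, a true relation of \<open>N\<close> of bounded length. So \<open>u\<close> and \<open>v\<close> are connected
  by recursively boundedly many steps over a fixed finite set of relations, which can be decided
  although the quasi-isometry is not computable.\<close>

section \<open>Recursive functions\<close>

text \<open>The lifts \<open>U\<close> and \<open>V\<close> are unknown; only their lengths are
  controlled. Hence the bound has to hold for all equal pairs of words below a given size at once,
  and the number of steps is the only information carried from one monoid to the other. It suffices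
  because, over a fixed finite rule set, it also bounds all intermediate words and so the whole
  search. Which relations of \<open>N\<close> belong to that rule set need not be known effectively:
  a finite set can be written into the algorithm as a table. Without inverses, equality of two words
  cannot be turned into triviality of one word, and distances are directed. The argument therefore
  follows pairs of parallel directed paths. If two words lead from a vertex \<open>y\<close> to the
  same vertex, left cancellation removes \<open>y\<close> from the equation, which then holds at
  every vertex. This turns the bounded squares met anywhere in the Cayley graph into finitely many
  global rules.\<close>

named_theorems rec_intros

lemma recursive_fn_proj [rec_intros]: "i < k \<Longrightarrow> recursive_fn k (\<lambda>xs. xs ! i)"
  by (rule recursive_fn.proj)

lemma recursive_fn_comp1:
  assumes "recursive_fn 1 (\<lambda>xs. g (xs ! 0))" "recursive_fn k f"
  shows "recursive_fn k (\<lambda>xs. g (f xs))"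
  using recursive_fn.comp[of "[f]" "\<lambda>xs. g (xs ! 0)" k] assms by simp

lemma recursive_fn_comp_list2:
  assumes "recursive_fn 2 g" "recursive_fn k f1" "recursive_fn k f2"
  shows "recursive_fn k (\<lambda>xs. g [f1 xs, f2 xs])"
  using recursive_fn.comp[of "[f1, f2]" g k] assms by (simp add: numeral_2_eq_2)

lemma recursive_fn_comp2:
  assumes "recursive_fn 2 (\<lambda>xs. g (xs ! 0) (xs ! 1))" "recursive_fn k f1" "recursive_fn k f2"
  shows "recursive_fn k (\<lambda>xs. g (f1 xs) (f2 xs))"
  using recursive_fn_comp_list2[OF assms] by simp

lemma recursive_fn_Suc [rec_intros]:
  "recursive_fn k f \<Longrightarrow> recursive_fn k (\<lambda>xs. Suc (f xs))"
  using recursive_fn_comp1 recursive_fn.succ .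

lemma recursive_fn_const [rec_intros]: "recursive_fn k (\<lambda>_. n)"
  by (induction n) (auto intro: recursive_fn.zero recursive_fn_Suc)

text \<open>One parameter \<open>y\<close> is enough, since several can be packed into it by
  \<open>prod_encode\<close>.\<close>

lemma recursive_fn_rec_nat:
  assumes g: "recursive_fn 1 (\<lambda>xs. g (xs ! 0))"
    and h: "recursive_fn 3 (\<lambda>xs. h (xs ! 0) (xs ! 1) (xs ! 2))"
    and n: "recursive_fn k n" and y: "recursive_fn k y"
  shows "recursive_fn k (\<lambda>xs. rec_nat (g (y xs)) (\<lambda>i r. h i r (y xs)) (n xs))"
proof -
  have "recursive_fn 2 (\<lambda>xs. rec_nat (g (tl xs ! 0))
      (\<lambda>i r. h ((i # r # tl xs) ! 0) ((i # r # tl xs) ! 1) ((i # r # tl xs) ! 2)) (hd xs))"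
    using recursive_fn.prim[of 1 "\<lambda>xs. g (xs ! 0)"
        "\<lambda>xs. h (xs ! 0) (xs ! 1) (xs ! 2)"] g h
    by (simp only: One_nat_def numeral_2_eq_2 numeral_3_eq_3)
  then have "recursive_fn 2 (\<lambda>xs. rec_nat (g (xs ! 1)) (\<lambda>i r. h i r (xs ! 1)) (xs ! 0))"
    by (rule recursive_fn.ext) (auto simp: length_Suc_conv numeral_2_eq_2)
  from recursive_fn_comp2[OF this n y] show ?thesis .
qed


lemma recursive_fn_add [rec_intros]:
  assumes "recursive_fn k f" "recursive_fn k g"
  shows "recursive_fn k (\<lambda>xs. f xs + g xs)"
proof -
  have "rec_nat y (\<lambda>i r. Suc r) n = n + y" for n y :: nat
    by (induction n) auto
  with recursive_fn_rec_nat[of "\<lambda>y. y" "\<lambda>i r y. Suc r", OF _ _ assms]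
  show ?thesis by (simp add: rec_intros)
qed

lemma recursive_fn_pred: 
  assumes "recursive_fn k f"
  shows "recursive_fn k (\<lambda>xs. f xs - 1)"
proof -
  have "rec_nat 0 (\<lambda>i r. i) n = n - 1" for n :: nat
    by (induction n) auto
  with recursive_fn_rec_nat[of "\<lambda>y. 0" "\<lambda>i r y. i", OF _ _ assms assms]
  show ?thesis by (simp add: rec_intros)
qed

lemma recursive_fn_diff [rec_intros]:
  assumes "recursive_fn k f" "recursive_fn k g"
  shows "recursive_fn k (\<lambda>xs. f xs - g xs)"
proof -
  have "rec_nat y (\<lambda>i r. r - 1) n = y - n" for n y :: nat
    by (induction n) auto
  with recursive_fn_rec_nat[of "\<lambda>y. y" "\<lambda>i r y. r - 1", OF _ _ assms(2,1)]
  show ?thesis by (simp add: rec_intros recursive_fn_pred del: One_nat_def)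
qed

lemma recursive_fn_sum:
  assumes g: "recursive_fn 2 (\<lambda>xs. g (xs ! 0) (xs ! 1))"
    and "recursive_fn k n" "recursive_fn k y"
  shows "recursive_fn k (\<lambda>xs. \<Sum>i<n xs. g i (y xs))"
proof -
  have "rec_nat 0 (\<lambda>i r. r + g i y) n = (\<Sum>i<n. g i y)" for n y :: nat
    by (induction n) auto
  with recursive_fn_rec_nat[of "\<lambda>y. 0" "\<lambda>i r y. r + g i y", OF _ _ assms(2,3)]
  show ?thesis by (simp add: rec_intros recursive_fn_comp2[OF g])
qed

lemma recursive_fn_mult [rec_intros]:
  assumes "recursive_fn k f" "recursive_fn k g"
  shows "recursive_fn k (\<lambda>xs. f xs * g xs)"
  using recursive_fn_sum[of "\<lambda>i y. y", OF _ assms] by (simp add: rec_intros)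

lemma recursive_fn_if [rec_intros]:
  assumes "recursive_fn k a" "recursive_fn k b" "recursive_fn k f" "recursive_fn k g"
  shows "recursive_fn k (\<lambda>xs. if a xs = b xs then f xs else g xs)"
proof -
  \<comment> \<open>Subtraction is truncated: \<open>(a - b) + (b - a)\<close> vanishes exactly when
    \<open>a = b\<close>, and \<open>1 - x\<close> indicates \<open>x = 0\<close>.\<close>
  have "(if a = b then f else g)
      = (1 - ((a - b) + (b - a))) * f + (1 - (1 - ((a - b) + (b - a)))) * g"
    for a b f g :: nat by auto
  then show ?thesis by (simp only:) (intro rec_intros assms)
qed

lemma recursive_fn_Least:
  assumes "recursive_fn 2 (\<lambda>xs. F (xs ! 0) (xs ! 1))" "\<And>y. \<exists>n. F n y = 0" "recursive_fn k y"
  shows "recursive_fn k (\<lambda>xs. LEAST n. F n (y xs) = 0)"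
proof -
  have "recursive_fn 1 (\<lambda>xs. LEAST n. F ((n # xs) ! 0) ((n # xs) ! 1) = 0)"
    using recursive_fn.mini[of 1 "\<lambda>xs. F (xs ! 0) (xs ! 1)"] assms(1,2)
    by (simp add: numeral_2_eq_2)
  from recursive_fn_comp1[of "\<lambda>x. LEAST n. F n x = 0", OF _ assms(3)] this
  show ?thesis by simp
qed

section \<open>The pairing function and its inverse\<close>

lemma recursive_fn_triangle [rec_intros]:
  assumes "recursive_fn k f"
  shows "recursive_fn k (\<lambda>xs. triangle (f xs))"
proof -
  have "(\<Sum>i<n. Suc i) = triangle n" for n
    by (induction n) auto
  with recursive_fn_sum[of "\<lambda>i y. Suc i", OF _ assms assms] show ?thesis
    by (simp add: rec_intros)
qed

lemma triangle_mono: "m \<le> n \<Longrightarrow> triangle m \<le> triangle n"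
  by (induction n rule: dec_induct) auto

lemma recursive_fn_prod_encode [rec_intros]:
  assumes "recursive_fn k f" "recursive_fn k g"
  shows "recursive_fn k (\<lambda>xs. prod_encode (f xs, g xs))"
  unfolding prod_encode_def split_conv by (intro rec_intros assms)

text \<open>A code \<open>z\<close> of \<open>(a, b)\<close> is \<open>triangle (a + b) + a\<close>,
  so the diagonal \<open>a + b\<close> is the least \<open>n\<close> with
  \<open>z < triangle (Suc n)\<close>, which is what \<open>F n z = 0\<close> says. Subtractions
  then recover both components.\<close>

lemma recursive_fn_prod_decode:
  assumes "recursive_fn k f"
  shows recursive_fn_fst [rec_intros]: "recursive_fn k (\<lambda>xs. fst (prod_decode (f xs)))"
    and recursive_fn_snd [rec_intros]: "recursive_fn k (\<lambda>xs. snd (prod_decode (f xs)))"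
proof -
  define F where "F n z = Suc z - triangle (Suc n)" for n z
  have ge: "n \<le> triangle n" for n by (induction n) auto
  have diag: "(LEAST n. F n (prod_encode (a, b)) = 0) = a + b" for a b
  proof (rule Least_equality)
    show "F (a + b) (prod_encode (a, b)) = 0"
      unfolding F_def by (simp add: prod_encode_def)
    show "a + b \<le> n" if "F n (prod_encode (a, b)) = 0" for n
    proof (rule ccontr)
      assume "\<not> a + b \<le> n"
      then have "triangle (Suc n) \<le> triangle (a + b)" by (intro triangle_mono) auto
      with that show False unfolding F_def prod_encode_def by simp
    qed
  qed
  let ?d = "\<lambda>z. LEAST n. F n z = 0"
  have "\<exists>n. F n z = 0" for z
    using ge[of "Suc z"] unfolding F_def by (intro exI[of _ z]) simp
  moreover have "recursive_fn 2 (\<lambda>xs. F (xs ! 0) (xs ! 1))"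
    unfolding F_def by (intro rec_intros) auto
  ultimately have d: "recursive_fn k (\<lambda>xs. ?d (f xs))"
    using assms by (intro recursive_fn_Least)
  have 1: "fst (prod_decode z) = z - triangle (?d z)" for z
  proof -
    obtain a b where z: "z = prod_encode (a, b)" by (metis prod_decode_inverse surj_pair)
    show ?thesis unfolding z diag prod_encode_inverse by (simp add: prod_encode_def)
  qed
  have 2: "snd (prod_decode z) = ?d z - fst (prod_decode z)" for z
  proof -
    obtain a b where z: "z = prod_encode (a, b)" by (metis prod_decode_inverse surj_pair)
    show ?thesis unfolding z diag by simp
  qed
  show fst: "recursive_fn k (\<lambda>xs. fst (prod_decode (f xs)))"
    unfolding 1 by (intro rec_intros assms d)
  show "recursive_fn k (\<lambda>xs. snd (prod_decode (f xs)))"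
    unfolding 2 by (intro rec_intros fst d)
qed

text \<open>Finite data enter the algorithms here as tables, however they were obtained: membership
  in a finite rule set and the images of single letters.\<close>

lemma recursive_fn_finite_support:
  assumes "finite A" "\<And>a. a \<notin> A \<Longrightarrow> h a = 0" "recursive_fn k f"
  shows "recursive_fn k (\<lambda>xs. h (f xs))"
  using assms(1,2)
proof (induction A arbitrary: h rule: finite_induct)
  case empty
  then show ?case by (simp add: rec_intros)
next
  case (insert a A)
  let ?h = "\<lambda>x. if x = a then 0 else h x"
  have "recursive_fn k (\<lambda>xs. ?h (f xs))"
    by (rule insert.IH[of ?h]) (use insert.prems in auto)
  then have "recursive_fn k (\<lambda>xs. if f xs = a then h a else ?h (f xs))"
    by (rule recursive_fn_if[OF assms(3) recursive_fn_const recursive_fn_const])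
  moreover have "(\<lambda>xs. if f xs = a then h a else ?h (f xs)) = (\<lambda>xs. h (f xs))"
    by auto
  ultimately show ?case by (simp only:)
qed

section \<open>Iteration over coded lists and bounds for codes\<close>

lemma length_le_list_encode: "length xs \<le> list_encode xs"
proof (induction xs)
  case (Cons x xs)
  then show ?case using le_prod_encode_2[of "list_encode xs" x] by simp
qed simp

text \<open>The pair of remaining list and accumulator is a single number, on which \<open>G\<close>
  performs one round. States with empty list, whose code is 0, are fixed by \<open>G\<close>. As a
  list is no longer than its code \<open>p\<close>, \<open>p\<close> rounds always finish, and
  surplus rounds do no harm.\<close>

lemma recursive_fn_fold:
  assumes st: "recursive_fn 2 (\<lambda>xs. st (xs ! 0) (xs ! 1))"
    and p: "recursive_fn k p" and x: "recursive_fn k x"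
  shows "recursive_fn k (\<lambda>xs. fold st (list_decode (p xs)) (x xs))"
proof -
  define G where "G s = (let p = fst (prod_decode s); x = snd (prod_decode s) in
    if p = 0 then s else prod_encode (snd (prod_decode (p - 1)), st (fst (prod_decode (p - 1))) x))"
    for s
  have G: "G (prod_encode (list_encode (a # as), x)) = prod_encode (list_encode as, st a x)"
    "G (prod_encode (0, x)) = prod_encode (0, x)" for a as x
    by (simp_all add: G_def)
  have stable: "(G ^^ n) (prod_encode (0, x)) = prod_encode (0, x)" for n x
    by (induction n) (simp_all add: G)
  have run: "(G ^^ n) (prod_encode (list_encode as, x)) = prod_encode (0, fold st as x)"
    if "length as \<le> n" for n as x
    using that
  proof (induction as arbitrary: n x)
    case Nil
    then show ?case by (simp add: stable)
  next
    case (Cons a as)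
    then obtain m where m: "n = Suc m" by (cases n) auto
    show ?case unfolding m funpow_Suc_right comp_apply G
      using Cons m by simp
  qed
  have "rec_nat s (\<lambda>i r. G r) n = (G ^^ n) s" for n s
    by (induction n) auto
  then have eq: "snd (prod_decode (rec_nat (prod_encode (p, x)) (\<lambda>i r. G r) (fst (prod_decode (prod_encode (p, x))))))
      = fold st (list_decode p) x" for p x
    using run[of "list_decode p" p x] length_le_list_encode[of "list_decode p"] by simp
  have "recursive_fn k (\<lambda>xs. snd (prod_decode (rec_nat (prod_encode (p xs, x xs))
      (\<lambda>i r. G r) (fst (prod_decode (prod_encode (p xs, x xs)))))))"
  proof (rule recursive_fn_snd, rule recursive_fn_rec_nat[of "\<lambda>y. y" "\<lambda>i r y. G r"])
    show "recursive_fn 3 (\<lambda>xs. G (xs ! 1))"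
      unfolding G_def Let_def by (intro rec_intros recursive_fn_comp2[OF st]) auto
  qed (intro rec_intros p x; simp)+
  then show ?thesis unfolding eq .
qed

text \<open>Pairing is monotone, so this is the largest code of a list of length at most
  \<open>n\<close> with entries at most \<open>e\<close>.\<close>

definition code_bound :: "nat \<Rightarrow> nat \<Rightarrow> nat" where
  "code_bound n e = list_encode (replicate n e)"

lemma prod_encode_mono: "a \<le> a' \<Longrightarrow> b \<le> b' \<Longrightarrow> prod_encode (a, b) \<le> prod_encode (a', b')"
proof -
  show "a \<le> a' \<Longrightarrow> b \<le> b' \<Longrightarrow> ?thesis"
    using triangle_mono[of "a + b" "a' + b'"] by (simp add: prod_encode_def)
qed

lemma list_encode_le_code_bound:
  assumes "length xs \<le> n" "\<forall>x\<in>set xs. x \<le> e"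
  shows "list_encode xs \<le> code_bound n e"
  using assms
proof (induction xs arbitrary: n)
  case (Cons x xs)
  then obtain m where m: "n = Suc m" by (cases n) auto
  with Cons show ?case by (simp add: code_bound_def prod_encode_mono)
qed (simp add: code_bound_def)

lemma code_bound_mono: "n \<le> n' \<Longrightarrow> e \<le> e' \<Longrightarrow> code_bound n e \<le> code_bound n' e'"
  unfolding code_bound_def[of n] by (rule list_encode_le_code_bound) auto

lemma recursive_fn_code_bound [rec_intros]:
  assumes "recursive_fn k n" "recursive_fn k e"
  shows "recursive_fn k (\<lambda>xs. code_bound (n xs) (e xs))"
proof -
  have "rec_nat 0 (\<lambda>i r. Suc (prod_encode (y, r))) n = code_bound n y" for n y
    by (induction n) (auto simp: code_bound_def)
  with recursive_fn_rec_nat[of "\<lambda>y. 0" "\<lambda>i r y. Suc (prod_encode (y, r))", OF _ _ assms]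
  show ?thesis by (simp add: rec_intros)
qed

lemma recursive_fn_bounded_ex:
  assumes P: "recursive_fn 2 (\<lambda>xs. if P (xs ! 0) (xs ! 1) then 1 else 0)"
    and n: "recursive_fn k n" and y: "recursive_fn k y"
  shows "recursive_fn k (\<lambda>xs. if \<exists>i\<le>n xs. P i (y xs) then 1 else 0)"
proof -
  have "(if \<exists>i\<le>n xs. P i (y xs) then 1 else (0::nat)) =
    (if (\<Sum>i<Suc (n xs). if P i (y xs) then 1 else 0) = (0::nat) then 0 else 1)" for xs
    by (auto simp del: sum.lessThan_Suc simp: less_Suc_eq_le Bex_def)
  then show ?thesis
    by (simp only:) (intro rec_intros n y recursive_fn_sum[of "\<lambda>i y. if P i y then 1 else 0"] P)
qed

section \<open>Coded rewriting\<close>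

definition rewrite :: "('x list \<times> 'x list) set \<Rightarrow> ('x list \<times> 'x list) set" where
  "rewrite R = {(p @ l @ q, p @ r @ q) | p l r q. (l, r) \<in> R}"

lemma rewriteI: "(l, r) \<in> R \<Longrightarrow> (p @ l @ q, p @ r @ q) \<in> rewrite R"
  unfolding rewrite_def by blast

lemma rewrite_relpow_context:
  "(u, v) \<in> rewrite R ^^ n \<Longrightarrow> (p @ u @ q, p @ v @ q) \<in> rewrite R ^^ n"
proof (induction n arbitrary: v)
  case (Suc n)
  then obtain w where w: "(u, w) \<in> rewrite R ^^ n" "(w, v) \<in> rewrite R" by auto
  then obtain p' l r q' where "w = p' @ l @ q'" "v = p' @ r @ q'" "(l, r) \<in> R"
    unfolding rewrite_def by blast
  then have "(p @ w @ q, p @ v @ q) \<in> rewrite R"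
    using rewriteI[of l r R "p @ p'" "q' @ q"] by simp
  with Suc.IH[OF w(1)] show ?case by auto
qed simp

text \<open>A step adds at most the length of the side that it inserts. This is how a bound on the
  number of steps limits the words to be searched.\<close>

lemma rewrite_relpow_length:
  assumes "\<And>l r. (l, r) \<in> R \<Longrightarrow> length r \<le> C" "(u, v) \<in> rewrite R ^^ n"
  shows "length v \<le> length u + n * C"
  using assms(2)
proof (induction n arbitrary: v)
  case (Suc n)
  then obtain w where w: "(u, w) \<in> rewrite R ^^ n" "(w, v) \<in> rewrite R" by auto
  then obtain p l r q where *: "w = p @ l @ q" "v = p @ r @ q" "(l, r) \<in> R"
    unfolding rewrite_def by blast
  with Suc.IH[OF w(1)] assms(1)[OF *(3)] show ?case by simp
qed simp

lemma rewrite_relpow_lists: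
  assumes "R \<subseteq> lists A \<times> lists A" "(u, v) \<in> rewrite R ^^ n" "u \<in> lists A"
  shows "v \<in> lists A"
  using assms(2)
proof (induction n arbitrary: v)
  case 0
  then show ?case using assms(3) by simp
next
  case (Suc n)
  then obtain w where w: "(u, w) \<in> rewrite R ^^ n" "(w, v) \<in> rewrite R" by auto
  then obtain p l r q where *: "w = p @ l @ q" "v = p @ r @ q" "(l, r) \<in> R"
    unfolding rewrite_def by blast
  with Suc.IH[OF w(1)] assms(1) show ?case by auto
qed

lemma relpow_sym: "sym r \<Longrightarrow> sym (r ^^ n)"
proof (induction n)
  case (Suc n)
  then show ?case
    by (auto simp: sym_def) (metis relcomp.relcompI relpow.simps(2) relpow_commute)
qed (auto simp: sym_def)

lemma sym_rewrite: "sym R \<Longrightarrow> sym (rewrite R)"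
  unfolding sym_def rewrite_def by blast

text \<open>Allowing any symmetric \<open>R'\<close> above \<open>R\<close> lets a set of short true
  relations take the place of the symmetric closure of \<open>R\<close>.\<close>

lemma pres_cong_rewrite:
  assumes "R \<subseteq> lists A \<times> lists A" "sym R'" "R \<subseteq> R'" "(u, v) \<in> pres_cong A R"
  shows "\<exists>n. (u, v) \<in> rewrite R' ^^ n"
  using assms(4)
proof (induction rule: pres_cong.induct)
  case (base u v)
  then have "(u, v) \<in> rewrite R' ^^ 1"
    using rewriteI[of u v R' "[]" "[]"] assms(3) by auto
  then show ?case ..
next
  case (refl u)
  have "(u, u) \<in> rewrite R' ^^ 0" by simp
  then show ?case ..
next
  case (sym u v)
  then show ?case using relpow_sym[OF sym_rewrite[OF assms(2)]] unfolding sym_def by blast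
next
  case (trans u v w)
  then obtain m n where "(u, v) \<in> rewrite R' ^^ m" "(v, w) \<in> rewrite R' ^^ n" by blast
  then have "(u, w) \<in> rewrite R' ^^ (m + n)" by (auto simp: relpow_add)
  then show ?case ..
next
  case (in_context u v p q)
  then show ?case by (blast intro: rewrite_relpow_context)
qed

text \<open>The fold pushes the entries of \<open>p\<close> one by one and so reverses them. Storing
  words reversed in the codes of steps makes this an ordinary append.\<close>

definition code_rev_append :: "nat \<Rightarrow> nat \<Rightarrow> nat" where
  "code_rev_append p x = fold (\<lambda>a x. Suc (prod_encode (a, x))) (list_decode p) x"

lemma code_rev_append:
  "code_rev_append p x = list_encode (rev (list_decode p) @ list_decode x)"
proof -
  have "fold (\<lambda>a x. Suc (prod_encode (a, x))) as x = list_encode (rev as @ list_decode x)" for as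
    by (induction as arbitrary: x) simp_all
  then show ?thesis by (simp add: code_rev_append_def)
qed

lemma recursive_fn_code_rev_append [rec_intros]:
  assumes "recursive_fn k p" "recursive_fn k x"
  shows "recursive_fn k (\<lambda>xs. code_rev_append (p xs) (x xs))"
  unfolding code_rev_append_def
  by (rule recursive_fn_fold[OF _ assms]) (intro rec_intros; simp)

text \<open>A rewriting step \<open>p l q \<rightarrow> p r q\<close> is coded by \<open>p\<close>, \<open>q\<close>, \<open>l\<close>, \<open>r\<close> with \<open>p\<close>, \<open>l\<close>, \<open>r\<close>
  reversed. Applying it to a word of another form has no effect.\<close>

definition step_code :: "nat list \<Rightarrow> nat list \<Rightarrow> nat list \<Rightarrow> nat list \<Rightarrow> nat" where
  "step_code p q l r = prod_encode (list_encode (rev p), prod_encode (list_encode q,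
    prod_encode (list_encode (rev l), list_encode (rev r))))"

definition rewrite_at :: "(nat list \<times> nat list) set \<Rightarrow> nat \<Rightarrow> nat \<Rightarrow> nat" where
  "rewrite_at R s w = (let
      p = fst (prod_decode s); s' = snd (prod_decode s);
      q = fst (prod_decode s'); lr = snd (prod_decode s');
      l = fst (prod_decode lr); r = snd (prod_decode lr) in
    if (if lr \<in> (\<lambda>(l, r). prod_encode (list_encode (rev l), list_encode (rev r))) ` R
        then 1 else 0) = (1 :: nat)
    then if w = code_rev_append p (code_rev_append l q)
      then code_rev_append p (code_rev_append r q) else w
    else w)"

text \<open>As every number codes a step, the numbers tried in a search need no test for being well
  formed.\<close>

lemma step_code_surj: "\<exists>p q l r. s = step_code p q l r"
proof -
  obtain p q l r where "s = prod_encode (p, prod_encode (q, prod_encode (l, r)))"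
    by (metis prod_decode_inverse surj_pair)
  then have "s = step_code (rev (list_decode p)) (list_decode q) (rev (list_decode l))
      (rev (list_decode r))"
    by (simp add: step_code_def)
  then show ?thesis by blast
qed

lemma rewrite_at_step_code:
  "rewrite_at R (step_code p q l r) (list_encode w) =
    list_encode (if (l, r) \<in> R \<and> w = p @ l @ q then p @ r @ q else w)"
proof -
  have "prod_encode (list_encode (rev l), list_encode (rev r)) \<in>
      (\<lambda>(l, r). prod_encode (list_encode (rev l), list_encode (rev r))) ` R \<longleftrightarrow> (l, r) \<in> R"
    by (auto simp: list_encode_eq)
  then show ?thesis
    by (simp add: rewrite_at_def step_code_def Let_def code_rev_append list_encode_eq)
qed

definition run :: "(nat list \<times> nat list) set \<Rightarrow> nat \<Rightarrow> nat \<Rightarrow> nat" where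
  "run R t w = fold (rewrite_at R) (list_decode t) w"

lemma recursive_fn_run [rec_intros]:
  assumes "finite R" "recursive_fn k t" "recursive_fn k w"
  shows "recursive_fn k (\<lambda>xs. run R (t xs) (w xs))"
  unfolding run_def
proof (rule recursive_fn_fold[OF _ assms(2,3)])
  let ?RC = "(\<lambda>(l, r). prod_encode (list_encode (rev l), list_encode (rev r))) ` R"
  \<comment> \<open>The membership test in \<open>rewrite_at\<close> compares this indicator with 1,
    because \<open>recursive_fn_if\<close> only branches on equality of numbers.\<close>
  have mem: "recursive_fn k f \<Longrightarrow> recursive_fn k (\<lambda>xs. if f xs \<in> ?RC then 1 else 0)" for k f
    by (rule recursive_fn_finite_support[of ?RC "\<lambda>x. if x \<in> ?RC then 1 else 0"])
      (use assms(1) in auto)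
  show "recursive_fn 2 (\<lambda>xs. rewrite_at R (xs ! 0) (xs ! 1))"
    unfolding rewrite_at_def Let_def by (intro rec_intros mem) simp_all
qed

text \<open>Steps that do not match are idle, so the derivation is at most as long as the list coded
  by \<open>t\<close>, hence at most \<open>t\<close>. A code found by search is thus itself a bound
  on the number of steps.\<close>

lemma run_imp_rewrite:
  assumes "run R t (list_encode u) = list_encode v"
  shows "\<exists>n\<le>t. (u, v) \<in> rewrite R ^^ n"
proof -
  have "\<exists>v n. fold (rewrite_at R) ss (list_encode u) = list_encode v \<and> n \<le> length ss \<and>
      (u, v) \<in> rewrite R ^^ n" for ss
  proof (induction ss rule: rev_induct)
    case Nil
    then show ?case by auto
  next
    case (snoc s ss)
    then obtain v n where v: "fold (rewrite_at R) ss (list_encode u) = list_encode v"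
      "n \<le> length ss" "(u, v) \<in> rewrite R ^^ n" by blast
    obtain p q l r where s: "s = step_code p q l r" using step_code_surj by blast
    show ?case
    proof (cases "(l, r) \<in> R \<and> v = p @ l @ q")
      case True
      then have "(v, p @ r @ q) \<in> rewrite R" by (auto intro: rewriteI)
      with v(3) have "(u, p @ r @ q) \<in> rewrite R ^^ Suc n" by auto
      then show ?thesis using True v(1,2)
        by (intro exI[of _ "p @ r @ q"] exI[of _ "Suc n"]) (simp add: s rewrite_at_step_code)
    next
      case False
      then show ?thesis using v
        by (intro exI[of _ v] exI[of _ n]) (auto simp: s rewrite_at_step_code)
    qed
  qed
  from this[of "list_decode t"] obtain n where
    "n \<le> length (list_decode t)" "(u, v) \<in> rewrite R ^^ n"
    using assms by (auto simp: run_def list_encode_eq)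
  then show ?thesis using length_le_list_encode[of "list_decode t"] by (auto dest: le_trans)
qed

text \<open>For letters up to \<open>m\<close> and rules with sides of length at most
  \<open>C\<close>, the words met in \<open>n\<close> steps from a word of length \<open>k\<close>
  have length at most \<open>k + n * C\<close> and code at most \<open>b\<close>. Four such codes
  make up a step, and \<open>n\<close> steps a derivation.\<close>

definition run_bound :: "nat \<Rightarrow> nat \<Rightarrow> nat \<Rightarrow> nat \<Rightarrow> nat" where
  "run_bound m C n k = (let b = code_bound (k + n * C) m in
    code_bound n (prod_encode (b, prod_encode (b, prod_encode (b, b)))))"

lemma run_bound_mono: "n \<le> n' \<Longrightarrow> k \<le> k' \<Longrightarrow> run_bound m C n k \<le> run_bound m C n' k'"
  unfolding run_bound_def Let_def
  by (intro code_bound_mono prod_encode_mono add_mono mult_mono) auto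

lemma recursive_fn_run_bound [rec_intros]:
  assumes "recursive_fn j n" "recursive_fn j k"
  shows "recursive_fn j (\<lambda>xs. run_bound m C (n xs) (k xs))"
  unfolding run_bound_def Let_def by (intro rec_intros assms)

lemma rewrite_imp_run:
  assumes R: "R \<subseteq> lists {..m} \<times> lists {..m}"
    and C: "\<And>l r. (l, r) \<in> R \<Longrightarrow> length l \<le> C \<and> length r \<le> C"
    and u: "u \<in> lists {..m}" and uv: "(u, v) \<in> rewrite R ^^ n"
  shows "\<exists>t\<le>run_bound m C n (length u). run R t (list_encode u) = list_encode v"
proof -
  define b where "b = code_bound (length u + n * C) m"
  define e where "e = prod_encode (b, prod_encode (b, prod_encode (b, b)))"
  have b: "list_encode w \<le> b" "list_encode (rev w) \<le> b"
    if "w \<in> lists {..m}" "length w \<le> length u + n * C" for w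
    unfolding b_def by (rule list_encode_le_code_bound; use that in auto)+
  have "\<exists>ss. length ss = i \<and> (\<forall>s\<in>set ss. s \<le> e) \<and>
      fold (rewrite_at R) ss (list_encode u) = list_encode w"
    if "(u, w) \<in> rewrite R ^^ i" "i \<le> n" for w i
    using that
  proof (induction i arbitrary: w)
    case 0
    then show ?case by auto
  next
    case (Suc i)
    then obtain x where x: "(u, x) \<in> rewrite R ^^ i" "(x, w) \<in> rewrite R" by auto
    from Suc.IH[OF x(1)] Suc.prems(2) obtain ss where ss: "length ss = i" "\<forall>s\<in>set ss. s \<le> e"
      "fold (rewrite_at R) ss (list_encode u) = list_encode x" by auto
    from x(2) obtain p l r q where *: "x = p @ l @ q" "w = p @ r @ q" "(l, r) \<in> R"
      unfolding rewrite_def by blast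
    have "length x \<le> length u + i * C"
      using rewrite_relpow_length[OF _ x(1)] C by blast
    also have "\<dots> \<le> length u + n * C" using Suc.prems(2) by simp
    finally have len: "length x \<le> length u + n * C" .
    have xm: "x \<in> lists {..m}" by (rule rewrite_relpow_lists[OF R x(1) u])
    \<comment> \<open>The side \<open>r\<close> is not a factor of \<open>x\<close>, so the bound on
      \<open>x\<close> does not cover it; there is room because \<open>n\<close> is
      positive.\<close>
    have "1 * C \<le> n * C" using Suc.prems(2) by (intro mult_right_mono) auto
    with C[OF *(3)] have "length r \<le> length u + n * C" by linarith
    moreover have "r \<in> lists {..m}" using R *(3) by auto
    ultimately have "step_code p q l r \<le> e"
      using len xm unfolding step_code_def e_def *(1)
      by (intro prod_encode_mono b) auto
    then show ?case using ss *
      by (intro exI[of _ "ss @ [step_code p q l r]"]) (auto simp: rewrite_at_step_code)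
  qed
  from this[OF uv] obtain ss where ss: "length ss = n" "\<forall>s\<in>set ss. s \<le> e"
    "fold (rewrite_at R) ss (list_encode u) = list_encode v" by auto
  have "list_encode ss \<le> run_bound m C n (length u)"
    unfolding run_bound_def Let_def
    by (rule list_encode_le_code_bound) (use ss in \<open>auto simp: e_def b_def\<close>)
  then show ?thesis using ss(3) by (intro exI[of _ "list_encode ss"]) (simp add: run_def)
qed

section \<open>Coarse equivalence\<close>

text \<open>Distance at most \<open>n\<close>, freed from \<open>ennreal\<close>: infinite distance
  means that no \<open>n\<close> works.\<close>

definition near :: "('a, 'm) monoid_scheme \<Rightarrow> 'a set \<Rightarrow> nat \<Rightarrow> 'a \<Rightarrow> 'a \<Rightarrow> bool" where
  "near M S n x y \<longleftrightarrow> (\<exists>w\<in>lists S. length w \<le> n \<and> x \<otimes>\<^bsub>M\<^esub> word_val M w = y)"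

lemma near_trans:
  assumes "monoid M" "S \<subseteq> carrier M" "x \<in> carrier M" "near M S n x y" "near M S m y z"
  shows "near M S (n + m) x z"
proof -
  interpret monoid M by fact
  obtain v where v: "v \<in> lists S" "length v \<le> n" "x \<otimes>\<^bsub>M\<^esub> word_val M v = y"
    using assms(4) unfolding near_def by auto
  obtain w where w: "w \<in> lists S" "length w \<le> m" "y \<otimes>\<^bsub>M\<^esub> word_val M w = z"
    using assms(5) unfolding near_def by auto
  have "x \<otimes>\<^bsub>M\<^esub> word_val M (v @ w) = z"
    unfolding word_val_append[OF assms(1,2) v(1) w(1)] v(3)[symmetric] w(3)[symmetric]
    using word_val_closed[OF assms(1,2)] v(1) w(1) assms(3) by (simp add: m_assoc)
  then show ?thesis unfolding near_def using v w by (intro bexI[of _ "v @ w"]) auto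
qed

lemma near_iff_word_dist: "near M S n x y \<longleftrightarrow> word_dist M S x y \<le> of_nat n"
proof
  assume "near M S n x y"
  then obtain w where "w \<in> lists S" "length w \<le> n" "x \<otimes>\<^bsub>M\<^esub> word_val M w = y"
    unfolding near_def by blast
  then show "word_dist M S x y \<le> of_nat n"
    using word_dist_le[of w S M x y] by (meson of_nat_le_iff order_trans)
next
  assume *: "word_dist M S x y \<le> of_nat n"
  then have "word_dist M S x y < \<infinity>"
    using of_nat_less_top[of n] by (simp add: le_less_trans)
  then obtain w where "w \<in> lists S" "x \<otimes>\<^bsub>M\<^esub> word_val M w = y" "word_dist M S x y = of_nat (length w)"
    by (rule word_dist_attained)
  with * show "near M S n x y" unfolding near_def by auto
qed

lemma word_val_concat:
  assumes "monoid M" "S \<subseteq> carrier M"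
    and "\<And>a. a \<in> set w \<Longrightarrow> \<tau> a \<in> lists S \<and> word_val M (\<tau> a) = h a"
  shows "concat (map \<tau> w) \<in> lists S \<and> word_val M (concat (map \<tau> w)) = word_val M (map h w)"
  using assms(3)
proof (induction w)
  case (Cons a w)
  then have IH: "concat (map \<tau> w) \<in> lists S"
    "word_val M (concat (map \<tau> w)) = word_val M (map h w)" by auto
  have "\<tau> a \<in> lists S" "word_val M (\<tau> a) = h a" using Cons.prems by auto
  with IH show ?case
    using word_val_append[OF assms(1,2) _ IH(1), of "\<tau> a"] by (auto simp: word_val_def)
qed (simp add: word_val_def)

lemma near_change_generators:
  assumes M: "monoid M" and S: "generates M S" and S': "finite S'" "S' \<subseteq> carrier M"
  shows "\<exists>C. \<forall>n x y. near M S' n x y \<longrightarrow> near M S (n * C) x y"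
proof -
  have "\<forall>s\<in>S'. \<exists>w\<in>lists S. word_val M w = s"
    using S S'(2) unfolding generates_def by (metis imageE subsetD)
  then obtain \<tau> where \<tau>: "\<And>s. s \<in> S' \<Longrightarrow> \<tau> s \<in> lists S \<and> word_val M (\<tau> s) = s" by metis
  \<comment> \<open>The sum, unlike a maximum, also covers an empty \<open>S'\<close>.\<close>
  define C where "C = (\<Sum>s\<in>S'. length (\<tau> s))"
  have len: "length (\<tau> s) \<le> C" if "s \<in> S'" for s
    unfolding C_def using S'(1) that by (intro member_le_sum) auto
  have "near M S (n * C) x y" if near: "near M S' n x y" for n x y
  proof -
    obtain w where w: "w \<in> lists S'" "length w \<le> n" "x \<otimes>\<^bsub>M\<^esub> word_val M w = y"
      using near unfolding near_def by blast
    have val: "concat (map \<tau> w) \<in> lists S" "word_val M (concat (map \<tau> w)) = word_val M w"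
      using word_val_concat[OF M, of S w \<tau> "\<lambda>s. s"] \<tau> w(1) S unfolding generates_def by auto
    have "length (concat (map \<tau> w)) \<le> length w * C"
      using w(1) by (induction w) (auto simp: add_mono len)
    also have "\<dots> \<le> n * C" using w(2) by simp
    finally show ?thesis unfolding near_def using val w(3)
      by (intro bexI[of _ "concat (map \<tau> w)"]) auto
  qed
  then show ?thesis by blast
qed

text \<open>The linear bounds of a quasi-isometry are weakened to an arbitrary dependence of
  \<open>m\<close> on \<open>n\<close>. Linear bounds on words return when paths are lifted edge by
  edge.\<close>

definition bornologous where
  "bornologous M S N T f \<longleftrightarrow> (\<forall>n. \<exists>m. \<forall>x\<in>carrier M. \<forall>y\<in>carrier M.
     near M S n x y \<longrightarrow> near N T m (f x) (f y))"

definition close_to_id where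
  "close_to_id M S f \<longleftrightarrow> (\<exists>m. \<forall>x\<in>carrier M. near M S m x (f x) \<and> near M S m (f x) x)"

text \<open>Asking for maps both ways makes the notion symmetric, so one transfer lemma yields both
  directions of the theorem.\<close>

definition coarse_equivalent where
  "coarse_equivalent M S N T \<longleftrightarrow> (\<exists>f g. f \<in> carrier M \<rightarrow> carrier N \<and> g \<in> carrier N \<rightarrow> carrier M \<and>
     bornologous M S N T f \<and> bornologous N T M S g \<and>
     close_to_id M S (\<lambda>x. g (f x)) \<and> close_to_id N T (\<lambda>y. f (g y)))"

lemma coarse_equivalent_sym: "coarse_equivalent M S N T \<Longrightarrow> coarse_equivalent N T M S"
  unfolding coarse_equivalent_def by blast

lemma coarse_equivalent_change_generators:
  assumes M: "monoid M" and S: "finite S" "generates M S" and S': "finite S'" "generates M S'"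
    and "coarse_equivalent M S N T"
  shows "coarse_equivalent M S' N T"
proof -
  obtain f g where fg: "f \<in> carrier M \<rightarrow> carrier N" "g \<in> carrier N \<rightarrow> carrier M"
     "bornologous M S N T f" "bornologous N T M S g"
     "close_to_id M S (\<lambda>x. g (f x))" "close_to_id N T (\<lambda>y. f (g y))"
    using assms(6) unfolding coarse_equivalent_def by blast
  obtain C where C: "\<And>n x y. near M S' n x y \<Longrightarrow> near M S (n * C) x y"
    using near_change_generators[OF M S(2) S'(1)] S'(2) unfolding generates_def by blast
  obtain C' where C': "\<And>n x y. near M S n x y \<Longrightarrow> near M S' (n * C') x y"
    using near_change_generators[OF M S'(2) S(1)] S(2) unfolding generates_def by blast
  have "bornologous M S' N T f"
    using fg(3) C unfolding bornologous_def by meson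
  moreover have "bornologous N T M S' g"
    using fg(4) C' unfolding bornologous_def by meson
  moreover have "close_to_id M S' (\<lambda>x. g (f x))"
    using fg(5) C' unfolding close_to_id_def by meson
  ultimately show ?thesis unfolding coarse_equivalent_def using fg by blast
qed

text \<open>The quasi-inverse \<open>g\<close> chooses, for each \<open>y\<close>, a point whose
  image is within \<mu> of \<open>y\<close> in both directions. It is controlled because the lower
  bound makes \<open>f\<close> reflect nearness.\<close>

lemma coarse_equivalent_of_quasi_isometric:
  assumes M: "monoid M" and S: "S \<subseteq> carrier M" and N: "monoid N" and T: "T \<subseteq> carrier N"
    and "quasi_isometric (carrier M) (word_dist M S) (carrier N) (word_dist N T)"
  shows "coarse_equivalent M S N T"
proof -
  obtain lam \<epsilon> \<mu> f where lam: "1 \<le> lam" and \<epsilon>: "0 < \<epsilon>" and \<mu>: "0 \<le> \<mu>"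
    and q: "quasi_isometry lam \<epsilon> \<mu> (carrier M) (word_dist M S) (carrier N) (word_dist N T) f"
    using assms(5) unfolding quasi_isometric_def by blast
  have lower: "word_dist M S x y / ennreal lam - ennreal \<epsilon> \<le> word_dist N T (f x) (f y)"
    and upper: "word_dist N T (f x) (f y) \<le> ennreal lam * word_dist M S x y + ennreal \<epsilon>"
    if "x \<in> carrier M" "y \<in> carrier M" for x y
    using q that unfolding quasi_isometry_def quasi_isometric_embedding_def by blast+
  have f: "f \<in> carrier M \<rightarrow> carrier N"
    and dense: "\<forall>y\<in>carrier N. \<exists>z\<in>f ` carrier M.
      word_dist N T y z \<le> ennreal \<mu> \<and> word_dist N T z y \<le> ennreal \<mu>"
    using q unfolding quasi_isometry_def quasi_isometric_embedding_def quasi_dense_def by blast+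
  have up: "\<exists>m. ennreal r \<le> of_nat m" for r
    using real_arch_simple[of r] by auto
  have f_near: "\<exists>m. \<forall>x\<in>carrier M. \<forall>y\<in>carrier M. near M S n x y \<longrightarrow> near N T m (f x) (f y)" for n
  proof -
    obtain m where m: "ennreal (lam * n + \<epsilon>) \<le> of_nat m" using up by blast
    have "word_dist N T (f x) (f y) \<le> of_nat m"
      if "x \<in> carrier M" "y \<in> carrier M" "word_dist M S x y \<le> of_nat n" for x y
    proof -
      have "word_dist N T (f x) (f y) \<le> ennreal lam * of_nat n + ennreal \<epsilon>"
        using upper[OF that(1,2)] that(3)
        by (meson add_right_mono mult_left_mono order_trans zero_le)
      also have "\<dots> = ennreal (lam * n + \<epsilon>)"
        using lam \<epsilon> by (simp add: ennreal_of_nat_eq_real_of_nat ennreal_mult)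
      finally show ?thesis using m by (rule order_trans)
    qed
    then show ?thesis unfolding near_iff_word_dist by blast
  qed
  have f_reflect: "\<exists>m. \<forall>x\<in>carrier M. \<forall>y\<in>carrier M. near N T n (f x) (f y) \<longrightarrow> near M S m x y" for n
  proof -
    obtain m where m: "ennreal (lam * (n + \<epsilon>)) \<le> of_nat m" using up by blast
    have "word_dist M S x y \<le> of_nat m"
      if xy: "x \<in> carrier M" "y \<in> carrier M" "word_dist N T (f x) (f y) \<le> of_nat n" for x y
    proof -
      have le: "word_dist M S x y / ennreal lam - ennreal \<epsilon> \<le> ennreal n"
        using lower[OF xy(1,2)] xy(3) by (simp add: ennreal_of_nat_eq_real_of_nat)
      show ?thesis
      proof (cases "word_dist M S x y")
        case (real r)
        then have "ennreal (r / lam - \<epsilon>) \<le> ennreal n"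
          using le lam \<epsilon> by (simp add: divide_ennreal ennreal_minus)
        then have "r / lam - \<epsilon> \<le> n" by simp
        then have "r \<le> lam * (n + \<epsilon>)" using lam by (simp add: field_simps)
        then show ?thesis using m real by (metis ennreal_leI order_trans)
      next
        \<comment> \<open>Infinity divided by \<open>lam\<close> and reduced by
          \<open>\<epsilon>\<close> is still infinite, contradicting the finite distance of the
          images.\<close>
        case top
        then show ?thesis using le lam by (simp add: ennreal_top_divide top_unique)
      qed
    qed
    then show ?thesis unfolding near_iff_word_dist by blast
  qed
  obtain e where e: "ennreal \<mu> \<le> of_nat e" using up by blast
  have "\<forall>y\<in>carrier N. \<exists>x\<in>carrier M. near N T e y (f x) \<and> near N T e (f x) y"
    unfolding near_iff_word_dist using dense e by (blast intro: order_trans)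
  then obtain g where g: "\<And>y. y \<in> carrier N \<Longrightarrow>
      g y \<in> carrier M \<and> near N T e y (f (g y)) \<and> near N T e (f (g y)) y" by metis
  have born_g: "bornologous N T M S g"
    unfolding bornologous_def
  proof
    fix n
    \<comment> \<open>The three terms are the ways from \<open>f (g x)\<close> to \<open>x\<close>,
      from \<open>x\<close> to \<open>y\<close>, and from \<open>y\<close> to
      \<open>f (g y)\<close>.\<close>
    obtain m where m: "\<forall>x\<in>carrier M. \<forall>y\<in>carrier M.
        near N T (e + n + e) (f x) (f y) \<longrightarrow> near M S m x y"
      using f_reflect by blast
    have "near M S m (g x) (g y)" if "x \<in> carrier N" "y \<in> carrier N" "near N T n x y" for x y
    proof -
      have "f (g x) \<in> carrier N" using f g[OF that(1)] by auto
      then have "near N T (e + n + e) (f (g x)) (f (g y))"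
        using g that near_trans[OF N T] by meson
      then show ?thesis using m g that by blast
    qed
    then show "\<exists>m. \<forall>x\<in>carrier N. \<forall>y\<in>carrier N. near N T n x y \<longrightarrow> near M S m (g x) (g y)"
      by blast
  qed
  obtain m where m: "\<forall>x\<in>carrier M. \<forall>y\<in>carrier M. near N T e (f x) (f y) \<longrightarrow> near M S m x y"
    using f_reflect by blast
  have "near M S m x (g (f x)) \<and> near M S m (g (f x)) x" if "x \<in> carrier M" for x
    using m g[of "f x"] f that by blast
  then have "close_to_id M S (\<lambda>x. g (f x))" unfolding close_to_id_def by blast
  moreover have "close_to_id N T (\<lambda>y. f (g y))" unfolding close_to_id_def using g by blast
  moreover have "g \<in> carrier N \<rightarrow> carrier M" using g by blast
  moreover have "bornologous M S N T f" unfolding bornologous_def using f_near by blast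
  ultimately show ?thesis unfolding coarse_equivalent_def using f born_g by blast
qed

section \<open>Transporting derivations\<close>

lemma word_val_Nil: "word_val M [] = \<one>\<^bsub>M\<^esub>"
  by (simp add: word_val_def)

lemma word_val_Cons: "word_val M (a # w) = a \<otimes>\<^bsub>M\<^esub> word_val M w"
  by (simp add: word_val_def)

text \<open>The map on vertices need not be a homomorphism, so the word for an edge depends on its
  starting vertex, and the lift of a word on the base point of its path.\<close>

primrec path_lift :: "('a, 'm) monoid_scheme \<Rightarrow> ('x \<Rightarrow> 'a) \<Rightarrow> ('a \<Rightarrow> 'x \<Rightarrow> 'y list) \<Rightarrow> 'x list \<Rightarrow> 'a \<Rightarrow> 'y list"
  where
  "path_lift M h \<phi> [] x = []"
| "path_lift M h \<phi> (a # U) x = \<phi> x a @ path_lift M h \<phi> U (x \<otimes>\<^bsub>M\<^esub> h a)"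

text \<open>Letters are kept apart from the elements they name: coded derivations need numbers as
  letters, and different letters of a presentation may name the same element.\<close>

locale edge_lift = M: monoid M + N: monoid N
  for M :: "('a, 'm) monoid_scheme" and N :: "('b, 'n) monoid_scheme" +
  fixes h :: "'x \<Rightarrow> 'a" and A and k :: "'y \<Rightarrow> 'b" and B and f and K :: nat and \<phi>
  assumes hA: "h ` A \<subseteq> carrier M" and kB: "k ` B \<subseteq> carrier N"
    and f: "f \<in> carrier M \<rightarrow> carrier N"
    and \<phi>: "\<And>x a. x \<in> carrier M \<Longrightarrow> a \<in> A \<Longrightarrow> \<phi> x a \<in> lists B \<and> length (\<phi> x a) \<le> K \<and>
      f x \<otimes>\<^bsub>N\<^esub> word_val N (map k (\<phi> x a)) = f (x \<otimes>\<^bsub>M\<^esub> h a)"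
begin

abbreviation "evM w \<equiv> word_val M (map h w)"
abbreviation "evN w \<equiv> word_val N (map k w)"
abbreviation "lift \<equiv> path_lift M h \<phi>"

lemma h_closed: "a \<in> A \<Longrightarrow> h a \<in> carrier M"
  using hA by auto

lemma evM_closed: "w \<in> lists A \<Longrightarrow> evM w \<in> carrier M"
  using word_val_closed[OF M.monoid_axioms hA] by (simp add: lists_image)

lemma evN_closed: "w \<in> lists B \<Longrightarrow> evN w \<in> carrier N"
  using word_val_closed[OF N.monoid_axioms kB] by (simp add: lists_image)

lemma evN_append: "v \<in> lists B \<Longrightarrow> w \<in> lists B \<Longrightarrow> evN (v @ w) = evN v \<otimes>\<^bsub>N\<^esub> evN w"
  using word_val_append[OF N.monoid_axioms kB] by (simp add: lists_image)

lemma f_closed: "x \<in> carrier M \<Longrightarrow> f x \<in> carrier N"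
  using f by auto

lemma path_lift:
  assumes "U \<in> lists A" "x \<in> carrier M"
  shows "lift U x \<in> lists B \<and> length (lift U x) \<le> K * length U \<and>
    f x \<otimes>\<^bsub>N\<^esub> evN (lift U x) = f (x \<otimes>\<^bsub>M\<^esub> evM U)"
  using assms
proof (induction U arbitrary: x rule: list.induct)
  case Nil
  then show ?case by (simp add: word_val_Nil word_val_Nil f_closed)
next
  case (Cons a U)
  then have a: "a \<in> A" "U \<in> lists A" by auto
  have "x \<otimes>\<^bsub>M\<^esub> h a \<in> carrier M" using Cons.prems h_closed a by auto
  note IH = Cons.IH[OF a(2) this]
  note p = \<phi>[OF Cons.prems(2) a(1)]
  have "f x \<otimes>\<^bsub>N\<^esub> evN (lift (a # U) x)
      = f x \<otimes>\<^bsub>N\<^esub> (evN (\<phi> x a) \<otimes>\<^bsub>N\<^esub> evN (lift U (x \<otimes>\<^bsub>M\<^esub> h a)))"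
    using IH p evN_append[of "\<phi> x a" "lift U (x \<otimes>\<^bsub>M\<^esub> h a)"] by simp
  also have "\<dots> = f (x \<otimes>\<^bsub>M\<^esub> h a) \<otimes>\<^bsub>N\<^esub> evN (lift U (x \<otimes>\<^bsub>M\<^esub> h a))"
    using IH p Cons.prems by (simp add: N.m_assoc[symmetric] f_closed evN_closed)
  also have "\<dots> = f (x \<otimes>\<^bsub>M\<^esub> evM (a # U))"
    using IH Cons.prems a by (simp add: M.m_assoc h_closed evM_closed word_val_Cons)
  finally show ?case using IH p by auto
qed

lemma path_lift_append:
  "U \<in> lists A \<Longrightarrow> x \<in> carrier M \<Longrightarrow> lift (U @ V) x = lift U x @ lift V (x \<otimes>\<^bsub>M\<^esub> evM U)"
proof (induction U arbitrary: x rule: list.induct)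
  case (Cons a U)
  then show ?case by (simp add: M.m_assoc h_closed evM_closed word_val_Cons)
qed (simp add: word_val_Nil)

end

definition short_relations ::
  "('a, 'm) monoid_scheme \<Rightarrow> ('x \<Rightarrow> 'a) \<Rightarrow> 'x set \<Rightarrow> nat \<Rightarrow> ('x list \<times> 'x list) set" where
  "short_relations M h A C = {(l, r). l \<in> lists A \<and> r \<in> lists A \<and> length l \<le> C \<and> length r \<le> C \<and>
     word_val M (map h l) = word_val M (map h r)}"

lemma sym_short_relations: "sym (short_relations M h A C)"
  by (auto simp: sym_def short_relations_def)

lemma finite_short_relations:
  assumes "finite A"
  shows "finite (short_relations M h A C)"
proof -
  have "finite {w. set w \<subseteq> A \<and> length w \<le> C}"
    by (rule finite_lists_length_le) (rule assms)
  then have "finite ({w. set w \<subseteq> A \<and> length w \<le> C} \<times> {w. set w \<subseteq> A \<and> length w \<le> C})"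
    by simp
  then show ?thesis by (rule rev_finite_subset) (auto simp: short_relations_def)
qed

lemma left_cancelD:
  "left_cancellative M \<Longrightarrow> x \<otimes>\<^bsub>M\<^esub> y = x \<otimes>\<^bsub>M\<^esub> z \<Longrightarrow> x \<in> carrier M \<Longrightarrow> y \<in> carrier M \<Longrightarrow>
    z \<in> carrier M \<Longrightarrow> y = z"
  unfolding left_cancellative_def by blast

context edge_lift
begin

text \<open>The change stays local although lifts depend on base points: \<open>l = r\<close> in
  \<open>M\<close>, so both paths enter \<open>q\<close> at the same vertex and \<open>q\<close> has
  one lift. The lifts of \<open>l\<close> and \<open>r\<close> join the same two vertices and have
  length at most \<open>K * L\<close>; left cancellation makes them a short relation.\<close>

lemma lift_rewrite:
  assumes lc: "left_cancellative N"
    and R: "R \<subseteq> short_relations M h A L" and C: "K * L \<le> C"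
    and UV: "(U, V) \<in> rewrite R" and U: "U \<in> lists A" and x: "x \<in> carrier M"
  shows "(lift U x, lift V x) \<in> rewrite (short_relations N k B C)"
proof -
  obtain p l r q where *: "U = p @ l @ q" "V = p @ r @ q" "(l, r) \<in> R"
    using UV unfolding rewrite_def by blast
  have lr: "l \<in> lists A" "r \<in> lists A" "length l \<le> L" "length r \<le> L" "evM l = evM r"
    using R *(3) unfolding short_relations_def by auto
  have pq: "p \<in> lists A" "q \<in> lists A" using U *(1) by auto
  define y where "y = x \<otimes>\<^bsub>M\<^esub> evM p"
  have y: "y \<in> carrier M" unfolding y_def using x pq by (simp add: evM_closed)
  define z where "z = y \<otimes>\<^bsub>M\<^esub> evM l"
  have eqs: "lift U x = lift p x @ lift l y @ lift q z" "lift V x = lift p x @ lift r y @ lift q z"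
    unfolding * y_def z_def using lr pq x evM_closed[OF pq(1)]
    by (simp_all add: path_lift_append)
  note l = path_lift[OF lr(1) y] and r = path_lift[OF lr(2) y]
  have "f y \<otimes>\<^bsub>N\<^esub> evN (lift l y) = f y \<otimes>\<^bsub>N\<^esub> evN (lift r y)" using l r lr(5) by simp
  then have "evN (lift l y) = evN (lift r y)"
    by (rule left_cancelD[OF lc]) (use l r y in \<open>auto simp: f_closed intro: evN_closed\<close>)
  moreover have "length (lift l y) \<le> C" "length (lift r y) \<le> C"
    using l r lr C mult_le_mono2[of _ L K] by (meson order_trans)+
  ultimately have "(lift l y, lift r y) \<in> short_relations N k B C"
    unfolding short_relations_def using l r by auto
  then show ?thesis unfolding eqs by (rule rewriteI)
qed

lemma lift_rewrite_relpow:
  assumes lc: "left_cancellative N"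
    and R: "R \<subseteq> short_relations M h A L" and C: "K * L \<le> C"
    and UV: "(U, V) \<in> rewrite R ^^ n" and U: "U \<in> lists A" and x: "x \<in> carrier M"
  shows "(lift U x, lift V x) \<in> rewrite (short_relations N k B C) ^^ n"
  using UV
proof (induction n arbitrary: V)
  case (Suc n)
  then obtain W where W: "(U, W) \<in> rewrite R ^^ n" "(W, V) \<in> rewrite R" by auto
  have "R \<subseteq> lists A \<times> lists A" using R unfolding short_relations_def by auto
  then have "W \<in> lists A" using rewrite_relpow_lists W(1) U by blast
  from lift_rewrite[OF lc R C W(2) this x] Suc.IH[OF W(1)] show ?case by auto
qed simp

end

text \<open>The word \<open>\<gamma> y\<close> leads from \<open>y\<close> to \<open>f (g y)\<close>
  and \<open>\<delta> y\<close> leads back; without inverses neither provides the other.\<close>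

locale coarse_pair = f: edge_lift M N h A k B f K \<phi> + g: edge_lift N M k B h A g K \<psi>
  for M :: "('a, 'm) monoid_scheme" and N :: "('b, 'n) monoid_scheme"
    and h :: "'x \<Rightarrow> 'a" and A and k :: "'y \<Rightarrow> 'b" and B and f g and K :: nat and \<phi> \<psi> +
  fixes \<gamma> \<delta>
  assumes lcM: "left_cancellative M" and lcN: "left_cancellative N"
    and \<gamma>: "\<And>y. y \<in> carrier N \<Longrightarrow> \<gamma> y \<in> lists B \<and> length (\<gamma> y) \<le> K \<and>
      y \<otimes>\<^bsub>N\<^esub> word_val N (map k (\<gamma> y)) = f (g y)"
    and \<delta>: "\<And>y. y \<in> carrier N \<Longrightarrow> \<delta> y \<in> lists B \<and> length (\<delta> y) \<le> K \<and>
      f (g y) \<otimes>\<^bsub>N\<^esub> word_val N (map k (\<delta> y)) = y"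
begin

text \<open>The connecting word moves from the end of \<open>u\<close> to its front, one letter per
  step. With \<open>z = y b\<close>, passing the letter \<open>b\<close> replaces
  \<open>b \<gamma>(z)\<close> by \<open>\<gamma>(y) w\<close>, where \<open>w\<close> is the double
  lift of the edge. Both lead from \<open>y\<close> to \<open>f (g z)\<close>, and their lengths are
  at most \<open>1 + K\<close> and \<open>K + K * K\<close>.\<close>

lemma round_trip:
  assumes C: "K + K * K + 1 \<le> C" and u: "u \<in> lists B" and y: "y \<in> carrier N"
  shows "(u @ \<gamma> (y \<otimes>\<^bsub>N\<^esub> f.evN u), \<gamma> y @ f.lift (g.lift u y) (g y))
    \<in> rewrite (short_relations N k B C) ^^ length u"
  using u y
proof (induction u arbitrary: y rule: list.induct)
  case Nil
  then show ?case by (simp add: word_val_Nil)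
next
  case (Cons b u)
  then have b: "b \<in> B" "u \<in> lists B" by auto
  define z where "z = y \<otimes>\<^bsub>N\<^esub> k b"
  have z: "z \<in> carrier N" unfolding z_def using Cons.prems b g.h_closed by auto
  note p = g.\<phi>[OF Cons.prems(2) b(1), folded z_def]
  have gy: "g y \<in> carrier M" using Cons.prems g.f_closed by auto
  note lp = f.path_lift[of "\<psi> y b" "g y"]
  define w where "w = f.lift (\<psi> y b) (g y)"
  have w: "w \<in> lists B" "length w \<le> K * K" "f (g y) \<otimes>\<^bsub>N\<^esub> f.evN w = f (g z)"
    using lp p gy mult_le_mono2[of "length (\<psi> y b)" K K] unfolding w_def by (auto intro: order_trans)
  note gy' = \<gamma>[OF Cons.prems(2)] and gz = \<gamma>[OF z]
  have lift_eq: "f.lift (g.lift (b # u) y) (g y) = w @ f.lift (g.lift u z) (g z)"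
    using f.path_lift_append[of "\<psi> y b" "g y"] p gy unfolding w_def by (simp add: z_def)
  have val: "y \<otimes>\<^bsub>N\<^esub> f.evN (b # u) = z \<otimes>\<^bsub>N\<^esub> f.evN u"
    unfolding z_def using Cons.prems b
    by (simp add: word_val_Cons f.N.m_assoc g.h_closed f.evN_closed)
  have kb: "[b] \<in> lists B" "word_val N [k b] = k b"
    using b g.h_closed by (auto simp: word_val_Cons word_val_Nil)
  have "y \<otimes>\<^bsub>N\<^esub> f.evN ([b] @ \<gamma> z) = f (g z)"
    using f.evN_append[OF kb(1), of "\<gamma> z"] gz Cons.prems b z
    by (simp add: kb(2) f.N.m_assoc[symmetric] g.h_closed f.evN_closed z_def)
  moreover have "y \<otimes>\<^bsub>N\<^esub> f.evN (\<gamma> y @ w) = f (g z)"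
    using f.evN_append[OF _ w(1), of "\<gamma> y"] gy' w Cons.prems
    by (simp add: f.N.m_assoc[symmetric] f.evN_closed)
  ultimately have "y \<otimes>\<^bsub>N\<^esub> f.evN ([b] @ \<gamma> z) = y \<otimes>\<^bsub>N\<^esub> f.evN (\<gamma> y @ w)" by simp
  then have "f.evN ([b] @ \<gamma> z) = f.evN (\<gamma> y @ w)"
    by (rule left_cancelD[OF lcN _ Cons.prems(2) f.evN_closed f.evN_closed])
      (use kb gy' gz w in auto)
  moreover have "length ([b] @ \<gamma> z) \<le> C" "length (\<gamma> y @ w) \<le> C"
    using gy' gz w(2) C by auto
  ultimately have "([b] @ \<gamma> z, \<gamma> y @ w) \<in> short_relations N k B C"
    unfolding short_relations_def using kb gy' gz w(1) by auto
  from rewriteI[OF this, of "[]" "f.lift (g.lift u z) (g z)"]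
  have "(b # \<gamma> z @ f.lift (g.lift u z) (g z), \<gamma> y @ w @ f.lift (g.lift u z) (g z))
      \<in> rewrite (short_relations N k B C)" by simp
  moreover have "(b # u @ \<gamma> (z \<otimes>\<^bsub>N\<^esub> f.evN u), b # \<gamma> z @ f.lift (g.lift u z) (g z))
      \<in> rewrite (short_relations N k B C) ^^ length u"
    using rewrite_relpow_context[OF Cons.IH[OF b(2) z], of "[b]" "[]"] by simp
  ultimately show ?case unfolding lift_eq val by auto
qed

text \<open>If \<open>u = v\<close> in \<open>N\<close>, then the lifts \<open>U\<close>, \<open>V\<close> of \<open>u\<close>, \<open>v\<close> to paths from \<open>g 1\<close> in \<open>M\<close> have the same
  endpoint. By left cancellativity \<open>U = V\<close> in \<open>M\<close>, and the lift to \<open>N\<close> of a derivation of \<open>V\<close> from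
  \<open>U\<close> connects the images of the two paths, which are close to \<open>u\<close> and \<open>v\<close>.\<close>

lemma transport_derivation:
  assumes C: "K + K * K + 1 \<le> C" "K * L \<le> C" "2 * K \<le> C"
    and R: "R \<subseteq> short_relations M h A L"
    and u: "u \<in> lists B" and v: "v \<in> lists B" and uv: "f.evN u = f.evN v"
  shows "\<exists>U\<in>lists A. \<exists>V\<in>lists A. length U \<le> K * length u \<and> length V \<le> K * length v \<and>
    f.evM U = f.evM V \<and> (\<forall>n. (U, V) \<in> rewrite R ^^ n \<longrightarrow>
      (u, v) \<in> rewrite (short_relations N k B C) ^^ (length u + n + length v + 2))"
proof -
  let ?Q = "short_relations N k B C" and ?e = "\<one>\<^bsub>N\<^esub>"
  have e: "?e \<in> carrier N" by simp
  define U where "U = g.lift u ?e"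
  define V where "V = g.lift v ?e"
  note U = g.path_lift[OF u e, folded U_def] and V = g.path_lift[OF v e, folded V_def]
  have x: "g ?e \<in> carrier M" using g.f_closed by auto
  have UV: "f.evM U = f.evM V"
    by (rule left_cancelD[OF lcM, of "g ?e"]) (use U V uv x in \<open>auto intro: f.evM_closed\<close>)
  define y where "y = f.evN u"
  have y: "y \<in> carrier N" unfolding y_def using u by (rule f.evN_closed)
  \<comment> \<open>The word \<open>\<gamma> y @ \<delta> y\<close> labels a closed path at
    \<open>y\<close>, so it is trivial by left cancellation; its length accounts for
    \<open>2 * K\<close>.\<close>
  have end_step: "(w @ \<gamma> y @ \<delta> y, w) \<in> rewrite ?Q" for w
  proof -
    have "y \<otimes>\<^bsub>N\<^esub> f.evN (\<gamma> y @ \<delta> y) = y \<otimes>\<^bsub>N\<^esub> f.evN []"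
      using \<gamma>[OF y] \<delta>[OF y] y f.evN_append[of "\<gamma> y" "\<delta> y"]
      by (simp add: f.N.m_assoc[symmetric] f.evN_closed word_val_Nil)
    then have "f.evN (\<gamma> y @ \<delta> y) = f.evN []"
      by (rule left_cancelD[OF lcN _ y f.evN_closed f.evN_closed]) (use \<gamma>[OF y] \<delta>[OF y] in auto)
    then have "(\<gamma> y @ \<delta> y, []) \<in> ?Q"
      using \<gamma>[OF y] \<delta>[OF y] C(3) unfolding short_relations_def by auto
    from rewriteI[OF this, of w "[]"] show ?thesis by simp
  qed
  \<comment> \<open>One step inserts the closed path at the end of \<open>w\<close>, then its first
    half travels to the front. The remaining \<open>\<delta> y\<close> is the same for
    \<open>u\<close> and \<open>v\<close>, which share the endpoint \<open>y\<close>.\<close>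
  have to_lift: "(w, \<gamma> ?e @ f.lift (g.lift w ?e) (g ?e) @ \<delta> y) \<in> rewrite ?Q ^^ (length w + 1)"
    if w: "w \<in> lists B" "f.evN w = y" for w
  proof -
    have "?e \<otimes>\<^bsub>N\<^esub> f.evN w = y" using w y by simp
    then have "(w @ \<gamma> y @ \<delta> y, \<gamma> ?e @ f.lift (g.lift w ?e) (g ?e) @ \<delta> y) \<in> rewrite ?Q ^^ length w"
      using rewrite_relpow_context[OF round_trip[OF C(1) w(1) e], of "[]" "\<delta> y"] by simp
    moreover have "(w, w @ \<gamma> y @ \<delta> y) \<in> rewrite ?Q"
      using end_step sym_rewrite[OF sym_short_relations] unfolding sym_def by blast
    ultimately show ?thesis using relpow_Suc_I2 by fastforce
  qed
  have "(u, v) \<in> rewrite ?Q ^^ (length u + n + length v + 2)" if n: "(U, V) \<in> rewrite R ^^ n" for n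
  proof -
    have "(f.lift U (g ?e), f.lift V (g ?e)) \<in> rewrite ?Q ^^ n"
      using f.lift_rewrite_relpow[OF lcN R C(2) n _ x] U by blast
    from rewrite_relpow_context[OF this, of "\<gamma> ?e" "\<delta> y"]
    have mid: "(\<gamma> ?e @ f.lift U (g ?e) @ \<delta> y, \<gamma> ?e @ f.lift V (g ?e) @ \<delta> y) \<in> rewrite ?Q ^^ n" .
    have 1: "(u, \<gamma> ?e @ f.lift U (g ?e) @ \<delta> y) \<in> rewrite ?Q ^^ (length u + 1)"
      unfolding U_def by (rule to_lift) (use u y_def in auto)
    have "(v, \<gamma> ?e @ f.lift V (g ?e) @ \<delta> y) \<in> rewrite ?Q ^^ (length v + 1)"
      unfolding V_def by (rule to_lift) (use v uv y_def in auto)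
    then have 2: "(\<gamma> ?e @ f.lift V (g ?e) @ \<delta> y, v) \<in> rewrite ?Q ^^ (length v + 1)"
      using relpow_sym[OF sym_rewrite[OF sym_short_relations]] unfolding sym_def by blast
    have "(u, v) \<in> rewrite ?Q ^^ ((length u + 1) + n + (length v + 1))"
      unfolding relpow_add[of "length u + 1 + n"] relpow_add[of "length u + 1"]
      using 1 mid 2 by blast
    then show ?thesis by (simp add: ac_simps)
  qed
  then show ?thesis using U V UV by blast
qed

end

section \<open>The word problem\<close>

text \<open>The isomorphism is used backwards: \<open>h\<close> sends a letter to the preimage of
  its class, and evaluation in \<open>M\<close> then corresponds to taking classes of words.\<close>

lemma finitely_presentable_marking:
  assumes M: "monoid M" and fp: "finitely_presentable M"
  obtains A :: "nat set" and h R where "finite A" "finite R" "R \<subseteq> lists A \<times> lists A"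
    "h ` A \<subseteq> carrier M" "generates M (h ` A)"
    "\<And>u v. u \<in> lists A \<Longrightarrow> v \<in> lists A \<Longrightarrow>
      word_val M (map h u) = word_val M (map h v) \<longleftrightarrow> (u, v) \<in> pres_cong A R"
proof -
  interpret M: monoid M by fact
  obtain A :: "nat set" and R where A: "finite A" "finite R" and R: "R \<subseteq> lists A \<times> lists A"
    and iso: "M \<cong> presented_monoid A R"
    using fp unfolding finitely_presentable_def by blast
  let ?P = "presented_monoid A R" and ?cl = "\<lambda>w. pres_cong A R `` {w}"
  interpret P: monoid ?P by (rule monoid_presented_monoid[OF R])
  have cl: "carrier ?P = ?cl ` lists A" by (auto simp: presented_monoid_def quotient_def)
  obtain \<phi> where "\<phi> \<in> Group.iso M ?P"
    using iso unfolding is_iso_def by blast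
  then have \<phi>: "\<phi> \<in> hom M ?P" "\<phi> ` carrier M = carrier ?P" "inj_on \<phi> (carrier M)"
    unfolding iso_iff by blast+
  \<comment> \<open>Membership in \<open>hom\<close> does not include the unit; surjectivity
    supplies an \<open>x\<close> over the unit, and \<open>x = x 1\<close> does the rest.\<close>
  have "\<phi> \<one>\<^bsub>M\<^esub> = \<one>\<^bsub>?P\<^esub>"
  proof -
    obtain x where x: "x \<in> carrier M" "\<phi> x = \<one>\<^bsub>?P\<^esub>"
      using \<phi>(2) P.one_closed by (metis imageE)
    have "\<phi> x = \<phi> x \<otimes>\<^bsub>?P\<^esub> \<phi> \<one>\<^bsub>M\<^esub>"
      using hom_mult[OF \<phi>(1) x(1) M.one_closed] x(1) by simp
    moreover have "\<phi> \<one>\<^bsub>M\<^esub> \<in> carrier ?P" using \<phi>(2) M.one_closed by blast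
    ultimately show ?thesis using x by simp
  qed
  then have one: "\<phi> \<one>\<^bsub>M\<^esub> = ?cl []" by (simp add: presented_monoid_def)
  define h where "h a = inv_into (carrier M) \<phi> (?cl [a])" for a
  have h: "h a \<in> carrier M" "\<phi> (h a) = ?cl [a]" if "a \<in> A" for a
  proof -
    have "?cl [a] \<in> \<phi> ` carrier M" unfolding \<phi>(2) cl using that by auto
    then show "h a \<in> carrier M" "\<phi> (h a) = ?cl [a]"
      unfolding h_def by (rule inv_into_into, rule f_inv_into_f)
  qed
  have hA: "h ` A \<subseteq> carrier M" using h(1) by auto
  have closed: "word_val M (map h w) \<in> carrier M" if "w \<in> lists A" for w
    using word_val_closed[OF M hA] that by (simp add: lists_image)
  have val: "\<phi> (word_val M (map h w)) = ?cl w" if "w \<in> lists A" for w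
    using that
  proof (induction w rule: list.induct)
    case Nil
    then show ?case by (simp add: word_val_Nil one)
  next
    case (Cons a w)
    then have a: "a \<in> A" "w \<in> lists A" by auto
    have "\<phi> (word_val M (map h (a # w))) = ?cl [a] \<otimes>\<^bsub>?P\<^esub> ?cl w"
      using hom_mult[OF \<phi>(1) h(1)[OF a(1)] closed[OF a(2)]] Cons.IH[OF a(2)] h(2)[OF a(1)]
      by (simp add: word_val_Cons)
    then show ?case using presented_monoid_mult[OF R, of "[a]" w] a by simp
  qed
  have gen: "generates M (h ` A)"
    unfolding generates_def
  proof (intro conjI hA equalityI subsetI)
    fix x assume x: "x \<in> carrier M"
    then have "\<phi> x \<in> ?cl ` lists A" using \<phi>(2) cl by blast
    then obtain w where w: "w \<in> lists A" "\<phi> x = ?cl w" by blast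
    then have "x = word_val M (map h w)"
      using val[OF w(1)] inj_onD[OF \<phi>(3) _ x closed[OF w(1)]] by simp
    then show "x \<in> word_val M ` lists (h ` A)" using w(1) by (auto simp: lists_image)
  next
    fix x assume "x \<in> word_val M ` lists (h ` A)"
    then show "x \<in> carrier M" using closed by (auto simp: lists_image)
  qed
  have "word_val M (map h u) = word_val M (map h v) \<longleftrightarrow> (u, v) \<in> pres_cong A R"
    if u: "u \<in> lists A" and v: "v \<in> lists A" for u v
    using inj_on_eq_iff[OF \<phi>(3) closed[OF u] closed[OF v]] val u v
      eq_equiv_class_iff[OF equiv_pres_cong[OF R] u v] by simp
  then show thesis using that A R hA gen by blast
qed

text \<open>The fold prepends, so its argument is read as the code of a reversed word. This is why
  the derivation bound below speaks of codes of \<open>rev u\<close>.\<close>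

definition translate :: "(nat \<Rightarrow> nat list) \<Rightarrow> nat \<Rightarrow> nat" where
  "translate \<tau> i = fold (\<lambda>a x. list_encode (\<tau> a @ list_decode x)) (list_decode i) 0"

lemma translate: "translate \<tau> i = list_encode (concat (map \<tau> (rev (list_decode i))))"
proof -
  have "fold (\<lambda>a x. list_encode (\<tau> a @ list_decode x)) as x
      = list_encode (concat (map \<tau> (rev as)) @ list_decode x)" for as x
    by (induction as arbitrary: x) simp_all
  then show ?thesis by (simp add: translate_def)
qed

lemma recursive_fn_translate:
  assumes "finite A" "\<And>a. a \<notin> A \<Longrightarrow> \<tau> a = []" "recursive_fn k i"
  shows "recursive_fn k (\<lambda>xs. translate \<tau> (i xs))"
  unfolding translate_def
proof (rule recursive_fn_fold[OF _ assms(3) recursive_fn_const])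
  have "recursive_fn 2 (\<lambda>xs. list_encode (rev (\<tau> (xs ! 0))))"
    by (rule recursive_fn_finite_support[OF assms(1), of "\<lambda>a. list_encode (rev (\<tau> a))"])
      (simp_all add: assms(2) rec_intros)
  then have "recursive_fn 2 (\<lambda>xs. code_rev_append (list_encode (rev (\<tau> (xs ! 0)))) (xs ! 1))"
    by (rule recursive_fn_code_rev_append) (simp add: rec_intros)
  then show "recursive_fn 2 (\<lambda>xs. list_encode (\<tau> (xs ! 0) @ list_decode (xs ! 1)))"
    by (simp add: code_rev_append)
qed

text \<open>Dropping foreign letters lets every number denote a word over \<open>A\<close>, so
  functions of codes are meaningful everywhere.\<close>

lemma translate_restrict:
  "translate (\<lambda>a. if a \<in> A then \<tau> a else []) i
    = list_encode (concat (map \<tau> (filter (\<lambda>a. a \<in> A) (rev (list_decode i)))))"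
proof -
  have "concat (map (\<lambda>a. if a \<in> A then \<tau> a else []) as)
      = concat (map \<tau> (filter (\<lambda>a. a \<in> A) as))" for as
    by (induction as) simp_all
  then show ?thesis by (simp add: translate)
qed

text \<open>The minimisation is total since it only searches for a derivation once the decision procedure
  has found the two words equal; the sum of its results bounds each of them.\<close>

lemma solvable_word_problem_imp_derivation_bound:
  assumes M: "monoid M" and swp: "solvable_word_problem M"
    and A: "finite A" "h ` A \<subseteq> carrier M"
    and R: "finite R" "R \<subseteq> lists A \<times> lists A"
    and complete: "\<And>u v. u \<in> lists A \<Longrightarrow> v \<in> lists A \<Longrightarrow>
      word_val M (map h u) = word_val M (map h v) \<Longrightarrow> \<exists>n. (u, v) \<in> rewrite R ^^ n"
  shows "\<exists>D. recursive_fn 1 (\<lambda>xs. D (xs ! 0)) \<and>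
    (\<forall>b. \<forall>u\<in>lists A. \<forall>v\<in>lists A. list_encode (rev u) \<le> b \<longrightarrow> list_encode (rev v) \<le> b \<longrightarrow>
      word_val M (map h u) = word_val M (map h v) \<longrightarrow> (\<exists>n\<le>D b. (u, v) \<in> rewrite R ^^ n))"
proof -
  obtain S c f where S: "generates M S"
    and f: "recursive_fn 2 f" and dec: "\<And>u v. u \<in> lists S \<Longrightarrow> v \<in> lists S \<Longrightarrow>
          f [list_encode (map c u), list_encode (map c v)] =
            (if word_val M u = word_val M v then 1 else 0)"
    using swp unfolding solvable_word_problem_def by blast
  have "\<forall>a\<in>A. \<exists>w\<in>lists S. word_val M w = h a"
    using S A(2) unfolding generates_def by (metis image_subset_iff imageE)
  then obtain \<tau> where \<tau>: "\<And>a. a \<in> A \<Longrightarrow> \<tau> a \<in> lists S \<and> word_val M (\<tau> a) = h a" by metis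
  \<comment> \<open>From the same number, \<open>\<sigma>\<close> produces the input for the given
    decision procedure over \<open>S\<close>, and \<open>\<rho>\<close> the word over
    \<open>A\<close> to be rewritten.\<close>
  define \<sigma> where "\<sigma> = translate (\<lambda>a. if a \<in> A then map c (\<tau> a) else [])"
  define \<rho> where "\<rho> = translate (\<lambda>a. if a \<in> A then [a] else [])"
  define word where "word i = filter (\<lambda>a. a \<in> A) (rev (list_decode i))" for i
  have word: "word i \<in> lists A" for i unfolding word_def by auto
  have \<rho>: "\<rho> i = list_encode (word i)" for i
    unfolding \<rho>_def translate_restrict word_def by simp
  have \<sigma>: "\<sigma> i = list_encode (map c (concat (map \<tau> (word i))))" for i
    unfolding \<sigma>_def translate_restrict word_def by (simp add: map_concat comp_def)
  have val: "concat (map \<tau> (word i)) \<in> lists S \<and>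
      word_val M (concat (map \<tau> (word i))) = word_val M (map h (word i))" for i
    by (rule word_val_concat[OF M]) (use S \<tau> word[of i] in \<open>auto simp: generates_def\<close>)
  have f\<sigma>: "f [\<sigma> i, \<sigma> j] =
      (if word_val M (map h (word i)) = word_val M (map h (word j)) then 1 else 0)" for i j
    unfolding \<sigma> using dec val by simp
  define F where "F t y = (let i = fst (prod_decode y); j = snd (prod_decode y) in
    if f [\<sigma> i, \<sigma> j] = 1 then if run R t (\<rho> i) = \<rho> j then 0 else 1 else (0::nat))" for t y
  define T where "T y = (LEAST t. F t y = 0)" for y
  have bound: "A \<subseteq> {..Max A}" using A(1) by auto
  obtain C where C: "\<And>l r. (l, r) \<in> R \<Longrightarrow> length l \<le> C \<and> length r \<le> C"
  proof -
    have *: "length l \<le> (\<Sum>p\<in>R. length (fst p) + length (snd p)) \<and>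
        length r \<le> (\<Sum>p\<in>R. length (fst p) + length (snd p))" if "(l, r) \<in> R" for l r
      using member_le_sum[OF that, of "\<lambda>p. length (fst p) + length (snd p)"] R(1) by simp
    show thesis using that * by blast
  qed
  have exF: "\<exists>t. F t y = 0" for y
  proof (cases "f [\<sigma> (fst (prod_decode y)), \<sigma> (snd (prod_decode y))] = 1")
    case True
    then have "word_val M (map h (word (fst (prod_decode y))))
        = word_val M (map h (word (snd (prod_decode y))))"
      unfolding f\<sigma> by (auto split: if_splits)
    from complete[OF word word this] obtain n where
      "(word (fst (prod_decode y)), word (snd (prod_decode y))) \<in> rewrite R ^^ n" by blast
    moreover have "R \<subseteq> lists {..Max A} \<times> lists {..Max A}"
      using R(2) lists_mono[OF bound] by blast
    moreover have "word (fst (prod_decode y)) \<in> lists {..Max A}"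
      using word lists_mono[OF bound] by blast
    ultimately obtain t where "run R t (\<rho> (fst (prod_decode y))) = \<rho> (snd (prod_decode y))"
      unfolding \<rho> using rewrite_imp_run[of R "Max A" C] C by meson
    then show ?thesis by (intro exI[of _ t]) (simp add: F_def Let_def)
  qed (simp add: F_def Let_def)
  have rec_\<sigma>: "recursive_fn k (\<lambda>xs. \<sigma> (i xs))" and rec_\<rho>: "recursive_fn k (\<lambda>xs. \<rho> (i xs))"
    if "recursive_fn k i" for k i
    unfolding \<sigma>_def \<rho>_def using that by (auto intro!: recursive_fn_translate[OF A(1)])
  have rec_T: "recursive_fn k (\<lambda>xs. T (y xs))" if "recursive_fn k y" for k y
    unfolding T_def
  proof (rule recursive_fn_Least[OF _ exF that])
    show "recursive_fn 2 (\<lambda>xs. F (xs ! 0) (xs ! 1))"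
      unfolding F_def Let_def
      by (intro rec_intros rec_\<sigma> rec_\<rho> R(1) recursive_fn_comp_list2[OF f]) simp_all
  qed
  define D where "D b = (\<Sum>i<Suc b. \<Sum>j<Suc b. T (prod_encode (j, i)))" for b
  have "recursive_fn 1 (\<lambda>xs. D (xs ! 0))"
  proof -
    have "recursive_fn 2 (\<lambda>xs. \<Sum>j<Suc (xs ! 1). T (prod_encode (j, xs ! 0)))"
      by (rule recursive_fn_sum[of "\<lambda>j i. T (prod_encode (j, i))"];
          intro rec_T rec_intros; simp)
    from recursive_fn_sum[of "\<lambda>i b. \<Sum>j<Suc b. T (prod_encode (j, i))", OF this]
    show ?thesis unfolding D_def by (simp add: rec_intros del: sum.lessThan_Suc)
  qed
  moreover have "\<exists>n\<le>D b. (u, v) \<in> rewrite R ^^ n"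
    if uv: "u \<in> lists A" "v \<in> lists A" "list_encode (rev u) \<le> b" "list_encode (rev v) \<le> b"
      "word_val M (map h u) = word_val M (map h v)" for b u v
  proof -
    define i j where "i = list_encode (rev u)" and "j = list_encode (rev v)"
    have w: "word i = u" "word j = v"
      unfolding word_def i_def j_def using uv(1,2) by (simp_all add: filter_id_conv in_lists_conv_set)
    have "F (T (prod_encode (i, j))) (prod_encode (i, j)) = 0"
      unfolding T_def by (rule LeastI_ex) (rule exF)
    then have "run R (T (prod_encode (i, j))) (list_encode u) = list_encode v"
      unfolding F_def Let_def by (simp add: f\<sigma> w \<rho> uv(5) split: if_splits)
    from run_imp_rewrite[OF this] obtain n where
      n: "n \<le> T (prod_encode (i, j))" "(u, v) \<in> rewrite R ^^ n" by blast
    have "T (prod_encode (i, j)) \<le> (\<Sum>i'<Suc b. T (prod_encode (i', j)))"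
      by (rule member_le_sum) (use uv in \<open>auto simp: i_def\<close>)
    also have "\<dots> \<le> D b"
      unfolding D_def by (rule member_le_sum[of j _ "\<lambda>j. \<Sum>i'<Suc b. T (prod_encode (i', j))"])
        (use uv in \<open>auto simp: j_def\<close>)
    finally show ?thesis using n by (blast intro: order_trans)
  qed
  ultimately show ?thesis by blast
qed

lemma rewrite_short_relations_sound:
  assumes M: "monoid M" and hA: "h ` A \<subseteq> carrier M"
    and uv: "(u, v) \<in> rewrite (short_relations M h A C) ^^ n" and u: "u \<in> lists A"
  shows "word_val M (map h u) = word_val M (map h v)"
  using uv
proof (induction n arbitrary: v)
  case (Suc n)
  then obtain w where w: "(u, w) \<in> rewrite (short_relations M h A C) ^^ n"
    "(w, v) \<in> rewrite (short_relations M h A C)" by auto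
  have "w \<in> lists A"
    by (rule rewrite_relpow_lists[OF _ w(1) u]) (auto simp: short_relations_def)
  moreover obtain p l r q where *: "w = p @ l @ q" "v = p @ r @ q"
    "(l, r) \<in> short_relations M h A C"
    using w(2) unfolding rewrite_def by blast
  ultimately have "map h p \<in> lists (h ` A)" "map h q \<in> lists (h ` A)" "map h l \<in> lists (h ` A)"
    "map h r \<in> lists (h ` A)" "word_val M (map h l) = word_val M (map h r)"
    by (auto simp: short_relations_def lists_image)
  then have "word_val M (map h w) = word_val M (map h v)"
    unfolding * map_append by (simp add: word_val_append[OF M hA])
  with Suc.IH[OF w(1)] show ?case by simp
qed simp

text \<open>The rules are true in \<open>N\<close>, so a derivation that is found proves equality.
  The bound makes the search finite, so its failure refutes equality.\<close>

lemma derivation_bound_imp_solvable_word_problem: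
  fixes k :: "nat \<Rightarrow> 'b"
  assumes N: "monoid N" and B: "finite B" "inj_on k B" "generates N (k ` B)"
    and E: "recursive_fn 2 (\<lambda>xs. E (xs ! 0) (xs ! 1))"
    and bound: "\<And>u v. u \<in> lists B \<Longrightarrow> v \<in> lists B \<Longrightarrow>
      word_val N (map k u) = word_val N (map k v) \<Longrightarrow>
      \<exists>n\<le>E (list_encode u) (list_encode v). (u, v) \<in> rewrite (short_relations N k B C) ^^ n"
  shows "solvable_word_problem N"
proof -
  let ?Q = "short_relations N k B C"
  have kB: "k ` B \<subseteq> carrier N" using B(3) unfolding generates_def by blast
  \<comment> \<open>The code \<open>x\<close> stands in for the length of the word that it
    codes.\<close>
  define b where "b x y = run_bound (Max B) C (E x y) x" for x y
  define P where "P t y \<longleftrightarrow> run ?Q t (fst (prod_decode y)) = snd (prod_decode y)" for t y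
  define g where "g x y = (if \<exists>t\<le>b x y. P t (prod_encode (x, y)) then 1 else 0 :: nat)" for x y
  have "recursive_fn 2 (\<lambda>xs. g (xs ! 0) (xs ! 1))"
    unfolding g_def
  proof (rule recursive_fn_bounded_ex)
    show "recursive_fn 2 (\<lambda>xs. if P (xs ! 0) (xs ! 1) then 1 else 0)"
      unfolding P_def
      by (intro rec_intros finite_short_relations B(1)) simp_all
    show "recursive_fn 2 (\<lambda>xs. b (xs ! 0) (xs ! 1))"
      unfolding b_def by (intro rec_intros recursive_fn_comp2[OF E]) simp_all
  qed (intro rec_intros; simp)
  moreover have dec: "g (list_encode u) (list_encode v) =
      (if word_val N (map k u) = word_val N (map k v) then 1 else 0)"
    if u: "u \<in> lists B" and v: "v \<in> lists B" for u v
  proof -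
    have "(\<exists>t\<le>b (list_encode u) (list_encode v). run ?Q t (list_encode u) = list_encode v)
      \<longleftrightarrow> word_val N (map k u) = word_val N (map k v)"
    proof
      assume "\<exists>t\<le>b (list_encode u) (list_encode v). run ?Q t (list_encode u) = list_encode v"
      then obtain n where "(u, v) \<in> rewrite ?Q ^^ n" using run_imp_rewrite by blast
      then show "word_val N (map k u) = word_val N (map k v)"
        using rewrite_short_relations_sound[OF N kB] u by blast
    next
      assume "word_val N (map k u) = word_val N (map k v)"
      then obtain n where n: "n \<le> E (list_encode u) (list_encode v)" "(u, v) \<in> rewrite ?Q ^^ n"
        using bound[OF u v] by blast
      have "B \<subseteq> {..Max B}" using B(1) by auto
      note le = lists_mono[OF this]
      have Q: "?Q \<subseteq> lists {..Max B} \<times> lists {..Max B}"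
        unfolding short_relations_def using le by blast
      have C: "length l \<le> C \<and> length r \<le> C" if "(l, r) \<in> ?Q" for l r
        using that unfolding short_relations_def by simp
      obtain t where "t \<le> run_bound (Max B) C n (length u)"
        "run ?Q t (list_encode u) = list_encode v"
        using rewrite_imp_run[OF Q C subsetD[OF le u] n(2)] by blast
      moreover have "run_bound (Max B) C n (length u) \<le> b (list_encode u) (list_encode v)"
        unfolding b_def by (intro run_bound_mono n(1) length_le_list_encode)
      ultimately show "\<exists>t\<le>b (list_encode u) (list_encode v). run ?Q t (list_encode u) = list_encode v"
        using order_trans by blast
    qed
    then show ?thesis unfolding g_def P_def by simp
  qed
  have "g (list_encode (map (inv_into B k) u)) (list_encode (map (inv_into B k) v)) =
      (if word_val N u = word_val N v then 1 else 0)"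
    if "u \<in> lists (k ` B)" "v \<in> lists (k ` B)" for u v
  proof -
    have inv: "map (inv_into B k) w \<in> lists B" "map k (map (inv_into B k) w) = w"
      if "w \<in> lists (k ` B)" for w
      using that by (auto simp: inv_into_into f_inv_into_f intro!: map_idI)
    show ?thesis using dec[OF inv(1) inv(1), OF that] unfolding inv(2)[OF that(1)] inv(2)[OF that(2)] .
  qed
  ultimately show ?thesis
    unfolding solvable_word_problem_def using B
    by (intro exI[of _ "k ` B"] exI[of _ "inv_into B k"] exI[of _ "\<lambda>xs. g (xs ! 0) (xs ! 1)"])
      (auto simp: inj_on_inv_into)
qed

section \<open>Transfer along a coarse equivalence\<close>

lemma nearD:
  assumes "near M (h ` A) n x y" "n \<le> m"
  shows "\<exists>w\<in>lists A. length w \<le> m \<and> x \<otimes>\<^bsub>M\<^esub> word_val M (map h w) = y"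
  using assms unfolding near_def lists_image by (auto intro: order_trans)

lemma near_generator:
  assumes "monoid M" "S \<subseteq> carrier M" "s \<in> S"
  shows "near M S 1 x (x \<otimes>\<^bsub>M\<^esub> s)"
proof -
  interpret monoid M by fact
  show ?thesis unfolding near_def
    using assms by (intro bexI[of _ "[s]"]) (auto simp: word_val_def)
qed

lemma coarse_pair_exists:
  assumes M: "monoid M" "left_cancellative M" "h ` A \<subseteq> carrier M"
    and N: "monoid N" "left_cancellative N" "k ` B \<subseteq> carrier N"
    and ce: "coarse_equivalent M (h ` A) N (k ` B)"
  shows "\<exists>f g K \<phi> \<psi> \<gamma> \<delta>. coarse_pair M N h A k B f g K \<phi> \<psi> \<gamma> \<delta>"
proof -
  obtain f g where f: "f \<in> carrier M \<rightarrow> carrier N" and g: "g \<in> carrier N \<rightarrow> carrier M"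
     and bf: "bornologous M (h ` A) N (k ` B) f" and bg: "bornologous N (k ` B) M (h ` A) g"
     and "close_to_id N (k ` B) (\<lambda>y. f (g y))"
    using ce unfolding coarse_equivalent_def by blast
  \<comment> \<open>Control at distance 1 handles single edges; concatenation extends it to
    paths.\<close>
  obtain m1 where m1: "\<And>x y. x \<in> carrier M \<Longrightarrow> y \<in> carrier M \<Longrightarrow> near M (h ` A) 1 x y \<Longrightarrow>
      near N (k ` B) m1 (f x) (f y)"
    using bf unfolding bornologous_def by blast
  obtain m2 where m2: "\<And>x y. x \<in> carrier N \<Longrightarrow> y \<in> carrier N \<Longrightarrow> near N (k ` B) 1 x y \<Longrightarrow>
      near M (h ` A) m2 (g x) (g y)"
    using bg unfolding bornologous_def by blast
  obtain m3 where m3: "\<And>y. y \<in> carrier N \<Longrightarrow>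
      near N (k ` B) m3 y (f (g y)) \<and> near N (k ` B) m3 (f (g y)) y"
    using \<open>close_to_id N _ _\<close> unfolding close_to_id_def by blast
  define K where "K = m1 + m2 + m3"
  interpret M: monoid M by fact
  interpret N: monoid N by fact
  have "\<exists>w\<in>lists B. length w \<le> K \<and>
      f x \<otimes>\<^bsub>N\<^esub> word_val N (map k w) = f (x \<otimes>\<^bsub>M\<^esub> h a)" if "x \<in> carrier M" "a \<in> A" for x a
    by (rule nearD[OF m1[OF _ _ near_generator[OF M(1,3)]]]) (use that M(3) K_def in auto)
  then obtain \<phi> where \<phi>: "\<And>x a. x \<in> carrier M \<Longrightarrow> a \<in> A \<Longrightarrow> \<phi> x a \<in> lists B \<and>
      length (\<phi> x a) \<le> K \<and> f x \<otimes>\<^bsub>N\<^esub> word_val N (map k (\<phi> x a)) = f (x \<otimes>\<^bsub>M\<^esub> h a)"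
    by metis
  have "\<exists>w\<in>lists A. length w \<le> K \<and>
      g x \<otimes>\<^bsub>M\<^esub> word_val M (map h w) = g (x \<otimes>\<^bsub>N\<^esub> k b)" if "x \<in> carrier N" "b \<in> B" for x b
    by (rule nearD[OF m2[OF _ _ near_generator[OF N(1,3)]]]) (use that N(3) K_def in auto)
  then obtain \<psi> where \<psi>: "\<And>x b. x \<in> carrier N \<Longrightarrow> b \<in> B \<Longrightarrow> \<psi> x b \<in> lists A \<and>
      length (\<psi> x b) \<le> K \<and> g x \<otimes>\<^bsub>M\<^esub> word_val M (map h (\<psi> x b)) = g (x \<otimes>\<^bsub>N\<^esub> k b)"
    by metis
  have "\<exists>w\<in>lists B. length w \<le> K \<and> y \<otimes>\<^bsub>N\<^esub> word_val N (map k w) = f (g y)"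
    "\<exists>w\<in>lists B. length w \<le> K \<and> f (g y) \<otimes>\<^bsub>N\<^esub> word_val N (map k w) = y"
    if "y \<in> carrier N" for y
    by (rule nearD[where n = m3]; use m3[OF that] K_def in simp)+
  then obtain \<gamma> \<delta> where "\<And>y. y \<in> carrier N \<Longrightarrow> \<gamma> y \<in> lists B \<and> length (\<gamma> y) \<le> K \<and>
      y \<otimes>\<^bsub>N\<^esub> word_val N (map k (\<gamma> y)) = f (g y)"
    "\<And>y. y \<in> carrier N \<Longrightarrow> \<delta> y \<in> lists B \<and> length (\<delta> y) \<le> K \<and>
      f (g y) \<otimes>\<^bsub>N\<^esub> word_val N (map k (\<delta> y)) = y"
    by metis
  then have "coarse_pair M N h A k B f g K \<phi> \<psi> \<gamma> \<delta>"
    using M N f g \<phi> \<psi> by unfold_locales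
  then show ?thesis by blast
qed

lemma solvable_word_problem_transfer:
  fixes M :: "('a, 'm) monoid_scheme" and N :: "('b, 'n) monoid_scheme"
  assumes M: "monoid M" "left_cancellative M" "finitely_presentable M"
    and N: "monoid N" "left_cancellative N"
    and S: "finite S" "generates M S" and T: "finite T" "generates N T"
    and ce: "coarse_equivalent M S N T" and swp: "solvable_word_problem M"
  shows "solvable_word_problem N"
proof -
  obtain A :: "nat set" and h R where A: "finite A" and R: "finite R" "R \<subseteq> lists A \<times> lists A"
    and hA: "h ` A \<subseteq> carrier M" "generates M (h ` A)"
    and pres: "\<And>u v. u \<in> lists A \<Longrightarrow> v \<in> lists A \<Longrightarrow>
      word_val M (map h u) = word_val M (map h v) \<longleftrightarrow> (u, v) \<in> pres_cong A R"
    using finitely_presentable_marking[OF M(1,3)] by metis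
  \<comment> \<open>Every side of a defining relation has length at most \<open>L\<close>, so the
    true relations of that length contain \<open>R\<close>.\<close>
  define L where "L = (\<Sum>p\<in>R. length (fst p) + length (snd p))"
  define R' where "R' = short_relations M h A L"
  have "R \<subseteq> R'"
  proof
    fix p assume p: "p \<in> R"
    have "length (fst p) + length (snd p) \<le> L"
      unfolding L_def using p R(1) by (intro member_le_sum[of p _ "\<lambda>p. length (fst p) + length (snd p)"]) auto
    moreover have "word_val M (map h (fst p)) = word_val M (map h (snd p))"
      using pres[of "fst p" "snd p"] p R(2) by (cases p) (auto intro: pres_cong.base)
    ultimately show "p \<in> R'" using p R(2) unfolding R'_def short_relations_def by (cases p) auto
  qed
  have "finite R'" unfolding R'_def by (rule finite_short_relations[OF A])
  have R'_lists: "R' \<subseteq> lists A \<times> lists A" unfolding R'_def short_relations_def by auto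
  have complete: "\<exists>n. (u, v) \<in> rewrite R' ^^ n"
    if "u \<in> lists A" "v \<in> lists A" "word_val M (map h u) = word_val M (map h v)" for u v
    using pres_cong_rewrite[OF R(2) _ \<open>R \<subseteq> R'\<close>] sym_short_relations pres that
    unfolding R'_def by blast
  obtain D where D: "recursive_fn 1 (\<lambda>xs. D (xs ! 0))"
    "\<And>b u v. u \<in> lists A \<Longrightarrow> v \<in> lists A \<Longrightarrow> list_encode (rev u) \<le> b \<Longrightarrow>
      list_encode (rev v) \<le> b \<Longrightarrow> word_val M (map h u) = word_val M (map h v) \<Longrightarrow>
      \<exists>n\<le>D b. (u, v) \<in> rewrite R' ^^ n"
    using solvable_word_problem_imp_derivation_bound[OF M(1) swp A hA(1)
        \<open>finite R'\<close> R'_lists complete]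
    by blast
  obtain k :: "nat \<Rightarrow> 'b" where k: "bij_betw k {0..<card T} T"
    using ex_bij_betw_nat_finite[OF T(1)] by blast
  define B where "B = {0..<card T}"
  have B: "finite B" "inj_on k B" "k ` B = T" using k unfolding B_def bij_betw_def by auto
  have kB: "k ` B \<subseteq> carrier N" using T(2) unfolding generates_def B(3) by blast
  have "coarse_equivalent M (h ` A) N (k ` B)"
    unfolding B(3) using coarse_equivalent_change_generators[OF M(1) S _ hA(2) ce] A by blast
  from coarse_pair_exists[OF M(1,2) hA(1) N kB this] obtain f g K \<phi> \<psi> \<gamma> \<delta>
    where "coarse_pair M N h A k B f g K \<phi> \<psi> \<gamma> \<delta>" by blast
  then interpret coarse_pair M N h A k B f g K \<phi> \<psi> \<gamma> \<delta> .
  \<comment> \<open>The summands pay for the squares of \<open>round_trip\<close>, the lifted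
    relations of \<open>M\<close>, and the closed paths
    \<open>\<gamma> y @ \<delta> y\<close>.\<close>
  define C where "C = K + K * K + 1 + K * L + 2 * K"
  \<comment> \<open>The argument of \<open>D\<close> exceeds the codes of all possible lifts, as
    \<open>x\<close> and \<open>y\<close> bound the lengths of the words they code. The remaining
    terms count the moves to and from the double lifts.\<close>
  define E where "E x y = x + D (code_bound (K * (x + y)) (Max A)) + y + 2" for x y
  show ?thesis
  proof (rule derivation_bound_imp_solvable_word_problem[OF N(1) B(1,2)])
    show "generates N (k ` B)" unfolding B(3) by (rule T(2))
    show "recursive_fn 2 (\<lambda>xs. E (xs ! 0) (xs ! 1))"
      unfolding E_def by (intro rec_intros recursive_fn_comp1[OF D(1)]) simp_all
    show "\<exists>n\<le>E (list_encode u) (list_encode v). (u, v) \<in> rewrite (short_relations N k B C) ^^ n"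
      if u: "u \<in> lists B" and v: "v \<in> lists B"
        and uv: "word_val N (map k u) = word_val N (map k v)" for u v
    proof -
      have "\<exists>U\<in>lists A. \<exists>V\<in>lists A. length U \<le> K * length u \<and> length V \<le> K * length v \<and>
        word_val M (map h U) = word_val M (map h V) \<and> (\<forall>n. (U, V) \<in> rewrite R' ^^ n \<longrightarrow>
          (u, v) \<in> rewrite (short_relations N k B C) ^^ (length u + n + length v + 2))"
        by (rule transport_derivation[OF _ _ _ _ u v uv, of C L]) (simp_all add: C_def R'_def)
      then obtain U V where UV: "U \<in> lists A" "V \<in> lists A" "length U \<le> K * length u"
        "length V \<le> K * length v" "word_val M (map h U) = word_val M (map h V)"
        and step: "\<And>n. (U, V) \<in> rewrite R' ^^ n \<Longrightarrow>
          (u, v) \<in> rewrite (short_relations N k B C) ^^ (length u + n + length v + 2)"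
        by blast
      let ?b = "code_bound (K * (list_encode u + list_encode v)) (Max A)"
      have len: "length u \<le> list_encode u" "length v \<le> list_encode v"
        by (rule length_le_list_encode)+
      have "list_encode (rev U) \<le> ?b" "list_encode (rev V) \<le> ?b"
        using UV len A
        by (auto intro!: list_encode_le_code_bound intro: order_trans[OF _ mult_le_mono2])
      then obtain n where n: "n \<le> D ?b" "(U, V) \<in> rewrite R' ^^ n"
        using D(2) UV by blast
      have "length u + n + length v + 2 \<le> E (list_encode u) (list_encode v)"
        unfolding E_def using n(1) len by simp
      then show ?thesis using step[OF n(2)] by blast
    qed
  qed
qed

theorem theoremB:
  fixes M :: "('a, 'm) monoid_scheme" and N :: "('b, 'n) monoid_scheme"
  assumes "monoid M" and "left_cancellative M" and "finitely_presentable M"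
    and "monoid N" and "left_cancellative N" and "finitely_presentable N"
    and "quasi_isometric_monoids M N"
  shows "solvable_word_problem M \<longleftrightarrow> solvable_word_problem N"
proof -
  obtain S T where S: "finite S" "generates M S" and T: "finite T" "generates N T"
    and "quasi_isometric (carrier M) (word_dist M S) (carrier N) (word_dist N T)"
    using assms(7) unfolding quasi_isometric_monoids_def by blast
  then have ce: "coarse_equivalent M S N T"
    using coarse_equivalent_of_quasi_isometric[OF assms(1) _ assms(4)]
    unfolding generates_def by blast
  show ?thesis
    using solvable_word_problem_transfer[OF assms(1-3) assms(4,5) S T ce]
      solvable_word_problem_transfer[OF assms(4-6) assms(1,2) T S coarse_equivalent_sym[OF ce]]
    by blast
qed

end
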